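(* Let $C\subset\mathbb{Z}^d$ be a $T$-periodic, $P$-connected set, and let $\Omega\subset\mathbb{R}^d$ be a bounded regular open set. Let $u^\varepsilon:\mathbb{Z}^d\cap\frac1\varepsilon\Omega\to\{+1,-1\}$ be a sequence (with $\varepsilon\to0^+$) such that $$\sup_\varepsilon\ \varepsilon^{d-1}\#\bigl\{(k,k')\in N^\varepsilon_C(\Omega):u^\varepsilon_k\neq u^\varepsilon_{k'}\bigr\}<+\infty .$$ Then there exist a constant $c=c(P)$ and a sequence $\widetilde u^\varepsilon:\mathbb{Z}^d\cap\frac1\varepsilon\Omega\to\{+1,-1\}$ such that $\widetilde u^\varepsilon_k=u^\varepsilon_k$ whenever $k\in C\cap\frac1\varepsilon\Omega$ and $\mathrm{dist}(k,\partial\frac1\varepsilon\Omega)>c$, and such that, up to subsequences, $\widetilde u^\varepsilon$ converges to some $u\in BV_{\rm loc}(\Omega;\{+1,-1\})$.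
   Context: $d,T$ are positive integers. $C\subset\mathbb{Z}^d$ is nonempty, and $T$-periodic means $C+m=C$ for all $m\in T\mathbb{Z}^d$. $P=\{P_k\}_{k\in C}$ is a family of finite sets $P_k\subset\mathbb{Z}^d$ that is $T$-periodic ($P_{k+m}=P_k$ for all $m\in T\mathbb{Z}^d$) and symmetric (if $k\in C$ and $i\in P_k$ then $k+i\in C$ and $-i\in P_{k+i}$), with $0\in P_k$. $C$ is $P$-connected if for all $k,k'\in C$ there is a path $k_0=k,k_1,\ldots,k_K=k'$ of points of $C$ with $k_n-k_{n-1}\in P_{k_{n-1}}$ for all $n$. $N^\varepsilon_C(\Omega)=\{(k,k')\in(C\times C)\cap\frac1\varepsilon(\Omega\times\Omega):k'-k\in P_k,\ k\ne k'\}$. The constant $c(P)$ depends only on the connection system ($C$ and $P$), not on $\varepsilon$ or on the sequence. Convergence of a sequence of discrete functions $u^\varepsilon:\mathbb{Z}^d\cap\frac1\varepsilon\Omega\to\mathbb{R}$ means $L^1_{\rm loc}(\Omega)$ convergence of their piecewise-constant interpolations $u^\varepsilon(x)=u^\varepsilon_{\lfloor x/\varepsilon\rfloor}$ (componentwise integer part); since convergence is local in $\Omega$, values near $\partial\Omega$ are irrelevant. *)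

theory Defs
  imports "HOL-Analysis.Analysis"
begin

section \<open>Periodic connection systems on the integer lattice\<close>

definition periodic_set :: "nat \<Rightarrow> (int ^ 'n) set \<Rightarrow> bool" where
  "periodic_set T C \<longleftrightarrow> (\<forall>z. (\<lambda>k. k + int T *s z) ` C = C)"

text \<open>The sets \<open>P k\<close> only matter for \<open>k \<in> C\<close>; the other values of \<open>P\<close> are unconstrained.\<close>

definition connection_system ::
    "nat \<Rightarrow> (int ^ 'n) set \<Rightarrow> (int ^ 'n \<Rightarrow> (int ^ 'n) set) \<Rightarrow> bool" where
  "connection_system T C P \<longleftrightarrow>
     (\<forall>k\<in>C. finite (P k) \<and> 0 \<in> P k \<and>
        (\<forall>z. P (k + int T *s z) = P k) \<and>
        (\<forall>i\<in>P k. k + i \<in> C \<and> - i \<in> P (k + i)))"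

definition P_connected :: "(int ^ 'n) set \<Rightarrow> (int ^ 'n \<Rightarrow> (int ^ 'n) set) \<Rightarrow> bool" where
  "P_connected C P \<longleftrightarrow>
     (\<forall>k\<in>C. \<forall>k'\<in>C. \<exists>(K::nat) p. p 0 = k \<and> p K = k' \<and> (\<forall>n\<le>K. p n \<in> C) \<and>
        (\<forall>n\<in>{1..K}. p n - p (n - 1) \<in> P (p (n - 1))))"

section \<open>Scaled lattices and discrete functions\<close>

definition lattice_vec :: "int ^ 'n \<Rightarrow> real ^ 'n" where
  "lattice_vec k = (\<chi> i. real_of_int (k $ i))"

definition dilate :: "real \<Rightarrow> (real ^ 'n) set \<Rightarrow> (real ^ 'n) set" where
  "dilate \<epsilon> \<Omega> = (\<lambda>x. (1 / \<epsilon>) *\<^sub>R x) ` \<Omega>"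

definition lattice_points :: "real \<Rightarrow> (real ^ 'n) set \<Rightarrow> (int ^ 'n) set" where
  "lattice_points \<epsilon> \<Omega> = {k. lattice_vec k \<in> dilate \<epsilon> \<Omega>}"

definition neighbours ::
    "(int ^ 'n) set \<Rightarrow> (int ^ 'n \<Rightarrow> (int ^ 'n) set) \<Rightarrow> real \<Rightarrow> (real ^ 'n) set
      \<Rightarrow> ((int ^ 'n) \<times> (int ^ 'n)) set" where
  "neighbours C P \<epsilon> \<Omega> =
     {(k, k'). k \<in> C \<and> k' \<in> C \<and> k \<in> lattice_points \<epsilon> \<Omega> \<and> k' \<in> lattice_points \<epsilon> \<Omega> \<and>
        k' - k \<in> P k \<and> k \<noteq> k'}"

text \<open>
  A discrete function on \<open>lattice_points \<epsilon> \<Omega>\<close> is represented by a total function on the lattice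
  whose values elsewhere are arbitrary. They do not affect convergence in \<open>L\<^sup>1\<^sub>l\<^sub>o\<^sub>c(\<Omega>)\<close> as
  \<open>\<epsilon>\<close> tends to \<open>0\<close>: for compact \<open>K \<subseteq> \<Omega>\<close> and small \<open>\<epsilon>\<close>, the interpolation on \<open>K\<close> only uses
  values at \<open>lattice_points \<epsilon> \<Omega>\<close>.
\<close>

definition interpolation :: "real \<Rightarrow> (int ^ 'n \<Rightarrow> real) \<Rightarrow> real ^ 'n \<Rightarrow> real" where
  "interpolation \<epsilon> u x = u (\<chi> i. \<lfloor>x $ i / \<epsilon>\<rfloor>)"

section \<open>Domains with Lipschitz boundary\<close>

text \<open>
  Near each boundary point, after a rigid motion, the set is the strict subgraph of a Lipschitz
  function over a hyperplane. Here \<open>v\<close> is the vertical direction, and the graph function \<open>g\<close> is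
  defined on the orthogonal complement of \<open>v\<close>.
\<close>

definition lipschitz_boundary :: "(real ^ 'n) set \<Rightarrow> bool" where
  "lipschitz_boundary \<Omega> \<longleftrightarrow>
     (\<forall>x\<in>frontier \<Omega>. \<exists>r>0. \<exists>v. norm v = 1 \<and>
        (\<exists>L g. L-lipschitz_on {z. z \<bullet> v = 0} g \<and>
           (\<forall>y\<in>ball x r. y \<in> \<Omega> \<longleftrightarrow> y \<bullet> v < g (y - (y \<bullet> v) *\<^sub>R v))))"

section \<open>Local integrability and functions of locally bounded variation\<close>

definition locally_integrable_on :: "(real ^ 'n \<Rightarrow> real) \<Rightarrow> (real ^ 'n) set \<Rightarrow> bool" where
  "locally_integrable_on f \<Omega> \<longleftrightarrow> (\<forall>K. compact K \<and> K \<subseteq> \<Omega> \<longrightarrow> set_integrable lebesgue K f)"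

definition L1_loc_converges ::
    "(real ^ 'n) set \<Rightarrow> (nat \<Rightarrow> real ^ 'n \<Rightarrow> real) \<Rightarrow> (real ^ 'n \<Rightarrow> real) \<Rightarrow> bool" where
  "L1_loc_converges \<Omega> f g \<longleftrightarrow>
     (\<forall>j. locally_integrable_on (f j) \<Omega>) \<and> locally_integrable_on g \<Omega> \<and>
     (\<forall>K. compact K \<and> K \<subseteq> \<Omega> \<longrightarrow>
        (\<lambda>j. LINT x:K|lebesgue. \<bar>f j x - g x\<bar>) \<longlonglongrightarrow> 0)"

text \<open>\<open>C\<^sup>1\<close> vector fields with compact support in \<open>V\<close>; in finite dimension, continuity of the
  derivative is continuity of all directional derivatives.\<close>

definition test_field :: "(real ^ 'n) set \<Rightarrow> (real ^ 'n \<Rightarrow> real ^ 'n) \<Rightarrow> bool" where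
  "test_field V \<phi> \<longleftrightarrow>
     (\<forall>x. \<phi> differentiable (at x)) \<and>
     (\<forall>h. continuous_on UNIV (\<lambda>x. frechet_derivative \<phi> (at x) h)) \<and>
     compact (closure {x. \<phi> x \<noteq> 0}) \<and> closure {x. \<phi> x \<noteq> 0} \<subseteq> V"

definition divergence :: "(real ^ 'n \<Rightarrow> real ^ 'n) \<Rightarrow> real ^ 'n \<Rightarrow> real" where
  "divergence \<phi> x = (\<Sum>i\<in>UNIV. frechet_derivative \<phi> (at x) (axis i 1) $ i)"

definition variation :: "(real ^ 'n \<Rightarrow> real) \<Rightarrow> (real ^ 'n) set \<Rightarrow> ereal" where
  "variation u V =
     (SUP \<phi>\<in>{\<phi>. test_field V \<phi> \<and> (\<forall>x. norm (\<phi> x) \<le> 1)}.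
        ereal (LINT x:V|lebesgue. u x * divergence \<phi> x))"

definition BV_loc :: "(real ^ 'n) set \<Rightarrow> (real ^ 'n \<Rightarrow> real) set" where
  "BV_loc \<Omega> =
     {u. locally_integrable_on u \<Omega> \<and>
         (\<forall>V. open V \<and> compact (closure V) \<and> closure V \<subseteq> \<Omega> \<longrightarrow> variation u V < \<infinity>)}"

definition BV_loc_spin :: "(real ^ 'n) set \<Rightarrow> (real ^ 'n \<Rightarrow> real) set" where
  "BV_loc_spin \<Omega> =
     {u \<in> BV_loc \<Omega>. AE x in lebesgue. x \<in> \<Omega> \<longrightarrow> u x \<in> {1, -1}}"

end

theory Submission
  imports Defs "HOL-Complex_Analysis.Great_Picard"
begin

text \<open>
  Transport the values of \<open>u\<close> from \<open>C\<close> to all of the lattice by a \<open>T\<close>-periodic retraction onto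
  \<open>C\<close> that moves points by a bounded distance; off \<open>C\<close> it sends a whole period cell to one point.
  The images of two adjacent lattice points are joined by a \<open>P\<close>-path that stays
  within a uniformly bounded distance, so each jump of the new function lies near a counted
  jump of \<open>u\<close>. Walking from \<open>x\<close> to \<open>x + z\<close> in steps of length at most \<open>\<epsilon>\<close> then gives, on compact
  subsets of \<open>\<Omega>\<close> and with a uniform constant \<open>A\<close>, that the \<open>L\<^sup>1\<close> norm of
  \<open>f (x + z) - f x\<close> is at most \<open>A * (norm z + \<epsilon>)\<close> for the interpolation \<open>f\<close>.
  This single estimate yields both compactness, by comparison with averages over small cells, and, in
  the limit \<open>\<epsilon> \<rightarrow> 0\<close>, a bound on the variation of the limit, by testing against difference quotients.
\<close>

section \<open>Retraction of the lattice\<close>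

definition cell :: "real \<Rightarrow> real ^ 'n \<Rightarrow> int ^ 'n" where
  "cell \<epsilon> x = (\<chi> i. \<lfloor>x $ i / \<epsilon>\<rfloor>)"

lemma interpolation_cell: "interpolation \<epsilon> u x = u (cell \<epsilon> x)"
  by (simp add: interpolation_def cell_def)

lemma cell_measurable [measurable]: "(cell \<epsilon> :: real ^ 'n \<Rightarrow> int ^ 'n) \<in> borel \<rightarrow>\<^sub>M count_space UNIV"
proof -
  have "cell \<epsilon> -` {k} \<in> sets borel" for k :: "int ^ 'n"
  proof -
    have "cell \<epsilon> -` {k} = (\<Inter>i. {x. \<lfloor>x $ i / \<epsilon>\<rfloor> = k $ i})"
      by (auto simp: cell_def vec_eq_iff)
    also have "\<dots> \<in> sets borel"
      by (intro sets.countable_INT'') auto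
    finally show ?thesis .
  qed
  then show ?thesis
    by (simp add: measurable_count_space_eq2_countable)
qed

lemma interpolation_measurable [measurable]: "interpolation \<epsilon> u \<in> borel_measurable borel"
proof -
  have "(\<lambda>x. u (cell \<epsilon> x)) \<in> borel_measurable borel"
    by (rule measurable_compose[OF cell_measurable]) simp
  then show ?thesis
    by (simp add: interpolation_cell[abs_def])
qed

lemma finite_vec_bounded: "finite {k :: 'a ^ 'n. \<forall>i. k $ i \<in> A i}" if "\<And>i. finite (A i)"
proof -
  have "{k :: 'a ^ 'n. \<forall>i. k $ i \<in> A i} \<subseteq> vec_lambda ` (Pi\<^sub>E UNIV A)"
    by (force simp: image_iff PiE_UNIV_domain intro!: bexI[of _ "vec_nth k" for k])
  then show ?thesis
    by (rule finite_subset) (auto intro!: finite_imageI finite_PiE that)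
qed

lemma lattice_points_iff:
  "k \<in> lattice_points \<epsilon> \<Omega> \<longleftrightarrow> \<epsilon> *\<^sub>R lattice_vec k \<in> \<Omega>" if "\<epsilon> > 0"
  using that by (force simp: lattice_points_def dilate_def)

lemma finite_lattice_points:
  fixes \<Omega> :: "(real ^ 'n) set"
  assumes "\<epsilon> > 0" "bounded \<Omega>"
  shows "finite (lattice_points \<epsilon> \<Omega>)"
proof -
  obtain B where B: "norm x \<le> B" if "x \<in> \<Omega>" for x
    using assms(2) bounded_iff by blast
  have "lattice_points \<epsilon> \<Omega> \<subseteq> {k. \<forall>i. k $ i \<in> {- \<lceil>B / \<epsilon>\<rceil>..\<lceil>B / \<epsilon>\<rceil>}}"
  proof safe
    fix k :: "int ^ 'n" and i assume "k \<in> lattice_points \<epsilon> \<Omega>"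
    then have "norm (\<epsilon> *\<^sub>R lattice_vec k) \<le> B"
      using B assms(1) lattice_points_iff by blast
    then have "\<bar>(\<epsilon> *\<^sub>R lattice_vec k) $ i\<bar> \<le> B"
      using component_le_norm_cart order_trans by blast
    then have "\<epsilon> * \<bar>real_of_int (k $ i)\<bar> \<le> B"
      using assms(1) by (simp add: lattice_vec_def abs_mult)
    then have "\<bar>real_of_int (k $ i)\<bar> \<le> B / \<epsilon>"
      using assms(1) by (simp add: field_simps)
    then show "k $ i \<in> {- \<lceil>B / \<epsilon>\<rceil>..\<lceil>B / \<epsilon>\<rceil>}"
      by (auto simp: abs_le_iff) linarith+
  qed
  then show ?thesis
    by (rule finite_subset) (rule finite_vec_bounded, simp)
qed

section \<open>The periodic retraction onto \<open>C\<close> and paths between its values\<close>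

lemma periodic_set_shift_iff:
  assumes "periodic_set T C"
  shows "k + int T *s z \<in> C \<longleftrightarrow> k \<in> C"
proof -
  have fwd: "k + int T *s z \<in> C" if "k \<in> C" for k z
    using assms that unfolding periodic_set_def by blast
  have cancel: "k + int T *s z + int T *s (- z) = k"
    by (simp add: vec_eq_iff)
  show ?thesis
    using fwd[of k z] fwd[of "k + int T *s z" "- z"] by (auto simp: cancel)
qed

text \<open>\<open>div\<close> rounds down for negative entries too, so the index of the period cell
  is equivariant and the map commutes with translations by multiples of \<open>T\<close>. Adding the
  index to one fixed \<open>k\<^sub>0\<close> requires no choice of a nearest point and no rule for
  ties.\<close>

definition retract_lattice ::
    "nat \<Rightarrow> (int ^ 'n) set \<Rightarrow> int ^ 'n \<Rightarrow> int ^ 'n \<Rightarrow> int ^ 'n" where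
  "retract_lattice T C k\<^sub>0 k =
     (if k \<in> C then k else k\<^sub>0 + int T *s (\<chi> i. k $ i div int T))"

lemma retract_lattice_shift:
  assumes "T > 0" "periodic_set T C"
  shows "retract_lattice T C k\<^sub>0 (k + int T *s z) = retract_lattice T C k\<^sub>0 k + int T *s z"
  using assms
  by (simp add: retract_lattice_def periodic_set_shift_iff vec_eq_iff algebra_simps)

lemma retract_lattice_in:
  assumes "periodic_set T C" "k\<^sub>0 \<in> C"
  shows "retract_lattice T C k\<^sub>0 k \<in> C"
  using assms by (simp add: retract_lattice_def periodic_set_shift_iff)

text \<open>The path condition of \<open>P_connected\<close>, reindexed from \<open>n - 1, n\<close>
  to \<open>n, Suc n\<close> so that inductions along a path avoid subtraction.\<close>

definition P_path :: "(int ^ 'n) set \<Rightarrow> (int ^ 'n \<Rightarrow> (int ^ 'n) set) \<Rightarrow> nat \<Rightarrow> (nat \<Rightarrow> int ^ 'n) \<Rightarrow> bool"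
  where "P_path C P K p \<longleftrightarrow> (\<forall>n\<le>K. p n \<in> C) \<and> (\<forall>n<K. p (Suc n) - p n \<in> P (p n))"

lemma P_connected_path:
  assumes "P_connected C P" "k \<in> C" "k' \<in> C"
  obtains K p where "p 0 = k" "p K = k'" "P_path C P K p"
proof -
  obtain K :: nat and p where p: "p 0 = k" "p K = k'" "\<forall>n\<le>K. p n \<in> C"
    "\<forall>n\<in>{1..K}. p n - p (n - 1) \<in> P (p (n - 1))"
    using assms unfolding P_connected_def by blast
  have "p (Suc n) - p n \<in> P (p n)" if "n < K" for n
    using p(4)[rule_format, of "Suc n"] that by simp
  with p show ?thesis by (intro that[of p K]) (auto simp: P_path_def)
qed

lemma P_path_shift:
  assumes "periodic_set T C" "connection_system T C P" "P_path C P K p"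
  shows "P_path C P K (\<lambda>n. p n + int T *s z)"
  using assms unfolding P_path_def connection_system_def
  by (auto simp: periodic_set_shift_iff)

text \<open>By periodicity only finitely many pairs \<open>(k, e)\<close> have to be connected.\<close>

lemma uniformly_bounded_paths:
  fixes T :: nat and C F :: "(int ^ 'n) set"
  defines "\<phi> \<equiv> \<lambda>k\<^sub>0. retract_lattice T C k\<^sub>0"
  assumes "T > 0" "periodic_set T C" "connection_system T C P" "P_connected C P"
    and "k\<^sub>0 \<in> C" "finite F"
  obtains R :: real where "R \<ge> 0"
    "\<And>k e. e \<in> F \<Longrightarrow> \<exists>K p. p 0 = \<phi> k\<^sub>0 k \<and> p K = \<phi> k\<^sub>0 (k + e) \<and> P_path C P K p \<and>
       (\<forall>n\<le>K. \<forall>i. \<bar>real_of_int (p n $ i - k $ i)\<bar> \<le> R)"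
proof -
  define good where "good R k e \<longleftrightarrow> (\<exists>K p. p 0 = \<phi> k\<^sub>0 k \<and> p K = \<phi> k\<^sub>0 (k + e) \<and> P_path C P K p \<and>
       (\<forall>n\<le>K. \<forall>i. \<bar>real_of_int (p n $ i - k $ i)\<bar> \<le> R))" for R k e
  have ex: "\<exists>R. good R k e" for k e
  proof -
    obtain K p where p: "p 0 = \<phi> k\<^sub>0 k" "p K = \<phi> k\<^sub>0 (k + e)" "P_path C P K p"
      using P_connected_path[OF assms(5)] retract_lattice_in assms unfolding \<phi>_def by metis
    let ?S = "(\<lambda>(n, i). \<bar>real_of_int (p n $ i - k $ i)\<bar>) ` ({..K} \<times> UNIV)"
    have "bdd_above ?S" by (intro bdd_above_finite) auto
    then obtain R where "\<forall>x\<in>?S. x \<le> R" unfolding bdd_above_def by blast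
    then have "good R k e" unfolding good_def using p by (intro exI[of _ K] exI[of _ p]) auto
    then show ?thesis ..
  qed
  then obtain R where R: "good (R k e) k e" for k e by metis
  \<comment> \<open>One representative of each residue class modulo \<open>T\<close>: translating a
    path from this box reaches every base point with the same deviation.\<close>
  define D where "D = {k :: int ^ 'n. \<forall>i. k $ i \<in> {0..<int T}}"
  have "finite D" unfolding D_def by (rule finite_vec_bounded) auto
  then have "bdd_above (case_prod R ` (D \<times> F))" using \<open>finite F\<close> by (intro bdd_above_finite) auto
  then obtain M where M: "R k e \<le> M" if "k \<in> D" "e \<in> F" for k e
    unfolding bdd_above_def by fast
  \<comment> \<open>The maximum with \<open>0\<close> provides a nonnegative radius even when
    \<open>F\<close> is empty and \<open>M\<close> is arbitrary.\<close>
  have "good (max 0 M) k e" if "e \<in> F" for k e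
  proof -
    define z where "z = (\<chi> i. k $ i div int T)"
    define k' where "k' = (\<chi> i. k $ i mod int T)"
    have k: "k = k' + int T *s z" by (simp add: vec_eq_iff k'_def z_def)
    have "k' \<in> D" using \<open>T > 0\<close> by (simp add: D_def k'_def)
    obtain K p where p: "p 0 = \<phi> k\<^sub>0 k'" "p K = \<phi> k\<^sub>0 (k' + e)" "P_path C P K p"
       "\<forall>n\<le>K. \<forall>i. \<bar>real_of_int (p n $ i - k' $ i)\<bar> \<le> R k' e"
      using R[of k' e] unfolding good_def by blast
    have "\<bar>real_of_int (p n $ i - k' $ i)\<bar> \<le> max 0 M" if "n \<le> K" for n i
      using p(4) that M[OF \<open>k' \<in> D\<close> \<open>e \<in> F\<close>] by (meson max.coboundedI2 order_trans)
    moreover have "k + e = (k' + e) + int T *s z" by (simp add: k)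
    then have "\<phi> k\<^sub>0 (k + e) = \<phi> k\<^sub>0 (k' + e) + int T *s z" "\<phi> k\<^sub>0 k = \<phi> k\<^sub>0 k' + int T *s z"
      using retract_lattice_shift[OF assms(2,3)] k by (simp_all only: \<phi>_def)
    ultimately show ?thesis
      unfolding good_def using p P_path_shift[OF assms(3,4) p(3), of z]
      by (intro exI[of _ K] exI[of _ "\<lambda>n. p n + int T *s z"]) (simp add: k)
  qed
  then show ?thesis
    by (intro that[of "max 0 M"]) (auto simp: good_def)
qed

section \<open>Shift estimate\<close>

lemma nn_integral_lborel_translate:
  fixes a :: "real ^ 'n"
  assumes [measurable]: "f \<in> borel_measurable borel"
  shows "(\<integral>\<^sup>+x. f (x + a) \<partial>lborel) = (\<integral>\<^sup>+x. f x \<partial>lborel)"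
proof -
  have "(\<integral>\<^sup>+x. f x \<partial>lborel) = (\<integral>\<^sup>+x. f x \<partial>distr lborel borel ((+) a))"
    by (simp add: lborel_distr_plus)
  also have "\<dots> = (\<integral>\<^sup>+x. f (a + x) \<partial>lborel)"
    by (rule nn_integral_distr) auto
  finally show ?thesis by (simp add: add.commute)
qed

text \<open>Here \<open>1\<close> is the vector with all entries \<open>1\<close>, so the box is the
  closed ball of radius \<open>r\<close> about \<open>a\<close> in the maximum norm.\<close>

lemma emeasure_cube:
  fixes a :: "real ^ 'n"
  assumes "r \<ge> 0"
  shows "emeasure lborel (cbox (a - r *\<^sub>R 1) (a + r *\<^sub>R 1)) = ennreal ((2 * r) ^ CARD('n))"
proof -
  have "emeasure lborel (cbox (a - r *\<^sub>R 1) (a + r *\<^sub>R 1)) =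
      ennreal (\<Prod>b\<in>Basis. ((a + r *\<^sub>R 1) - (a - r *\<^sub>R 1)) \<bullet> (b :: real ^ 'n))"
    using assms by (intro emeasure_lborel_cbox) (auto simp: Basis_vec_def cart_eq_inner_axis[symmetric])
  also have "(\<Prod>b\<in>Basis. ((a + r *\<^sub>R 1) - (a - r *\<^sub>R 1)) \<bullet> (b :: real ^ 'n)) = (\<Prod>b\<in>(Basis :: (real ^ 'n) set). 2 * r)"
    by (intro prod.cong) (auto simp: Basis_vec_def cart_eq_inner_axis[symmetric])
  finally show ?thesis by simp
qed

lemma mem_cube: "x \<in> cbox (a - r *\<^sub>R 1) (a + r *\<^sub>R (1 :: real ^ 'n)) \<longleftrightarrow> (\<forall>i. \<bar>x $ i - a $ i\<bar> \<le> r)"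
  unfolding mem_box_cart by (intro arg_cong[where f = All] ext) (simp add: abs_le_iff; linarith)

section \<open>From jumps of the extension to counted jumps, and from single steps to
  translations\<close>

definition jumps ::
    "(int ^ 'n) set \<Rightarrow> (int ^ 'n \<Rightarrow> (int ^ 'n) set) \<Rightarrow> real \<Rightarrow> (real ^ 'n) set \<Rightarrow> (int ^ 'n \<Rightarrow> real)
      \<Rightarrow> ((int ^ 'n) \<times> (int ^ 'n)) set" where
  "jumps C P \<epsilon> \<Omega> u = {(k, k') \<in> neighbours C P \<epsilon> \<Omega>. u k \<noteq> u k'}"

lemma finite_jumps:
  assumes "\<epsilon> > 0" "bounded \<Omega>"
  shows "finite (jumps C P \<epsilon> \<Omega> u)"
  by (rule finite_subset[of _ "lattice_points \<epsilon> \<Omega> \<times> lattice_points \<epsilon> \<Omega>"])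
    (auto simp: jumps_def neighbours_def finite_lattice_points assms)

text \<open>Near the boundary the retraction may leave the dilated domain, where \<open>u\<close> is
  unconstrained; the default \<open>1\<close> keeps the extension a spin on the whole
  lattice.\<close>

definition lattice_extension ::
    "nat \<Rightarrow> (int ^ 'n) set \<Rightarrow> int ^ 'n \<Rightarrow> real \<Rightarrow> (real ^ 'n) set \<Rightarrow> (int ^ 'n \<Rightarrow> real) \<Rightarrow> int ^ 'n \<Rightarrow> real"
  where "lattice_extension T C k\<^sub>0 \<epsilon> \<Omega> u k =
    (if retract_lattice T C k\<^sub>0 k \<in> lattice_points \<epsilon> \<Omega> then u (retract_lattice T C k\<^sub>0 k) else 1)"

text \<open>The offsets \<open>e\<close> are those between the cells of two points whose coordinates
  differ by at most \<open>\<epsilon>\<close>. \<open>R\<close> controls the entire path, in lattice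
  units, and depends on neither \<open>\<epsilon>\<close> nor the domain.\<close>

definition connecting_radius ::
    "nat \<Rightarrow> (int ^ 'n) set \<Rightarrow> (int ^ 'n \<Rightarrow> (int ^ 'n) set) \<Rightarrow> int ^ 'n \<Rightarrow> real \<Rightarrow> bool" where
  "connecting_radius T C P k\<^sub>0 R \<longleftrightarrow> R \<ge> 0 \<and>
    (\<forall>k e. (\<forall>i. \<bar>e $ i\<bar> \<le> 1) \<longrightarrow>
       (\<exists>K p. p 0 = retract_lattice T C k\<^sub>0 k \<and> p K = retract_lattice T C k\<^sub>0 (k + e) \<and> P_path C P K p \<and>
       (\<forall>n\<le>K. \<forall>i. \<bar>real_of_int (p n $ i - k $ i)\<bar> \<le> R)))"

lemma connecting_radius_exists:
  fixes T :: nat and C :: "(int ^ 'n) set"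
  assumes "T > 0" "periodic_set T C" "connection_system T C P" "P_connected C P" "k\<^sub>0 \<in> C"
  obtains R where "connecting_radius T C P k\<^sub>0 R"
proof -
  have "finite {e :: int ^ 'n. \<forall>i. e $ i \<in> {-1..1}}"
    by (rule finite_vec_bounded) simp
  from uniformly_bounded_paths[OF assms this] obtain R where R: "R \<ge> 0"
    "\<And>k e. e \<in> {e. \<forall>i. e $ i \<in> {-1..1}} \<Longrightarrow> \<exists>K p. p 0 = retract_lattice T C k\<^sub>0 k \<and>
       p K = retract_lattice T C k\<^sub>0 (k + e) \<and> P_path C P K p \<and>
       (\<forall>n\<le>K. \<forall>i. \<bar>real_of_int (p n $ i - k $ i)\<bar> \<le> R)"
    by blast
  have "e \<in> {e. \<forall>i. e $ i \<in> {-1..1}}" if "\<forall>i. \<bar>e $ i\<bar> \<le> 1" for e :: "int ^ 'n"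
    using that by (auto simp: abs_le_iff minus_le_iff)
  with R show ?thesis
    by (intro that[of R]) (simp only: connecting_radius_def, blast)
qed

text \<open>Distinct values at \<open>x\<close> and \<open>y\<close> mean that \<open>u\<close>
  differs at the two ends of the path joining the retracted cells. Hence \<open>u\<close> changes
  along some step of that path, and such a step is a counted pair as soon as the path stays in the
  dilated domain, which \<open>deep\<close> ensures.\<close>

lemma near_jump:
  fixes \<Omega> :: "(real ^ 'n) set"
  defines "u' \<equiv> \<lambda>T C k\<^sub>0 \<epsilon> u. interpolation \<epsilon> (lattice_extension T C k\<^sub>0 \<epsilon> \<Omega> u)"
  assumes R: "connecting_radius T C P k\<^sub>0 R" and "\<epsilon> > 0"
    and near: "\<And>i. \<bar>y $ i - x $ i\<bar> \<le> \<epsilon>"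
    and deep: "\<And>q. (\<And>i. \<bar>q $ i - x $ i\<bar> \<le> (R + 1) * \<epsilon>) \<Longrightarrow> q \<in> \<Omega>"
    and jump: "u' T C k\<^sub>0 \<epsilon> u y \<noteq> u' T C k\<^sub>0 \<epsilon> u x"
  shows "\<exists>(k, k') \<in> jumps C P \<epsilon> \<Omega> u. \<forall>i. \<bar>x $ i - (\<epsilon> *\<^sub>R lattice_vec k) $ i\<bar> \<le> (R + 1) * \<epsilon>"
proof -
  define k where "k = cell \<epsilon> x"
  define e where "e = cell \<epsilon> y - k"
  have "\<bar>e $ i\<bar> \<le> 1" for i
  proof -
    have "\<bar>y $ i / \<epsilon> - x $ i / \<epsilon>\<bar> \<le> 1"
      using near[of i] \<open>\<epsilon> > 0\<close> by (simp add: diff_divide_distrib[symmetric] abs_divide)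
    then show ?thesis unfolding e_def k_def cell_def by (simp add: abs_le_iff) linarith
  qed
  then obtain K p where p: "p 0 = retract_lattice T C k\<^sub>0 k" "p K = retract_lattice T C k\<^sub>0 (k + e)"
      "P_path C P K p" "\<And>n i. n \<le> K \<Longrightarrow> \<bar>real_of_int (p n $ i - k $ i)\<bar> \<le> R"
    using R unfolding connecting_radius_def by blast
  \<comment> \<open>\<open>R\<close> accounts for the deviation of the path from \<open>k\<close>,
    the additional \<open>1\<close> for rounding \<open>x / \<epsilon>\<close> down to
    \<open>k\<close>.\<close>
  have close: "\<bar>(\<epsilon> *\<^sub>R lattice_vec (p n)) $ i - x $ i\<bar> \<le> (R + 1) * \<epsilon>" if "n \<le> K" for n i
  proof -
    have "\<bar>real_of_int (k $ i) - x $ i / \<epsilon>\<bar> \<le> 1"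
      unfolding k_def cell_def by (simp add: abs_le_iff) linarith
    then have "\<bar>real_of_int (p n $ i) - x $ i / \<epsilon>\<bar> \<le> R + 1"
      using p(4)[OF that, of i] by simp
    then have "\<epsilon> * \<bar>real_of_int (p n $ i) - x $ i / \<epsilon>\<bar> \<le> \<epsilon> * (R + 1)"
      using \<open>\<epsilon> > 0\<close> by (intro mult_left_mono) auto
    moreover have "\<epsilon> * \<bar>real_of_int (p n $ i) - x $ i / \<epsilon>\<bar> = \<bar>\<epsilon> * (real_of_int (p n $ i) - x $ i / \<epsilon>)\<bar>"
      using \<open>\<epsilon> > 0\<close> by (simp add: abs_mult)
    ultimately show ?thesis
      using \<open>\<epsilon> > 0\<close> by (simp add: lattice_vec_def algebra_simps)
  qed
  \<comment> \<open>This excludes the default value of the extension at both ends and makes every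
    step of the path eligible for \<open>neighbours\<close>.\<close>
  have lattice: "p n \<in> lattice_points \<epsilon> \<Omega>" if "n \<le> K" for n
    unfolding lattice_points_iff[OF \<open>\<epsilon> > 0\<close>] using close[OF that] by (rule deep)
  have "u (p 0) \<noteq> u (p K)"
    using jump lattice[of 0] lattice[of K] p(1,2)
    by (simp add: u'_def interpolation_cell lattice_extension_def e_def k_def)
  have "\<exists>n<K. u (p n) \<noteq> u (p (Suc n))"
  proof (rule ccontr)
    assume *: "\<not> (\<exists>n<K. u (p n) \<noteq> u (p (Suc n)))"
    have "u (p n) = u (p 0)" if "n \<le> K" for n
      using that
    proof (induction n)
      case (Suc n)
      then have "u (p n) = u (p (Suc n))" using * Suc_le_eq by blast
      with Suc show ?case by simp
    qed simp
    from this[OF order_refl] \<open>u (p 0) \<noteq> u (p K)\<close> show False by simp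
  qed
  then obtain n where n: "n < K" "u (p n) \<noteq> u (p (Suc n))" by blast
  then have "p n \<in> C" "p (Suc n) \<in> C" "p (Suc n) - p n \<in> P (p n)"
    using p(3) n(1) Suc_leI[OF n(1)] less_imp_le[OF n(1)] unfolding P_path_def by blast+
  moreover have "p n \<noteq> p (Suc n)"
    using n(2) by metis
  ultimately have "(p n, p (Suc n)) \<in> jumps C P \<epsilon> \<Omega> u"
    using lattice[of n] lattice[of "Suc n"] n by (simp add: jumps_def neighbours_def)
  moreover have "\<bar>x $ i - (\<epsilon> *\<^sub>R lattice_vec (p n)) $ i\<bar> \<le> (R + 1) * \<epsilon>" for i
    using close[of n i] n(1) by (simp add: abs_minus_commute)
  ultimately show ?thesis by blast
qed

text \<open>The segment from \<open>x\<close> to \<open>x + z\<close> is cut into \<open>N\<close>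
  equal steps and the difference telescoped. Each step costs a translate of \<open>g\<close>, and
  all translates have the same integral.\<close>

lemma shift_estimate_chain:
  fixes U :: "real ^ 'n \<Rightarrow> real" and g :: "real ^ 'n \<Rightarrow> ennreal"
  assumes [measurable]: "g \<in> borel_measurable borel" and "N > 0"
    and step: "\<And>x t s. \<lbrakk>x \<in> K; 0 \<le> t; t \<le> 1; s = t + 1 / real N\<rbrakk> \<Longrightarrow>
      ennreal \<bar>U (x + s *\<^sub>R z) - U (x + t *\<^sub>R z)\<bar> \<le> g (x + t *\<^sub>R z)"
  shows "(\<integral>\<^sup>+x\<in>K. ennreal \<bar>U (x + z) - U x\<bar> \<partial>lborel) \<le> of_nat N * (\<integral>\<^sup>+x. g x \<partial>lborel)"
proof -
  have "(\<integral>\<^sup>+x\<in>K. ennreal \<bar>U (x + z) - U x\<bar> \<partial>lborel) \<le>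
      (\<integral>\<^sup>+x. (\<Sum>l<N. g (x + (real l / real N) *\<^sub>R z)) \<partial>lborel)"
  proof (intro nn_integral_mono)
    fix x
    show "ennreal \<bar>U (x + z) - U x\<bar> * indicator K x \<le> (\<Sum>l<N. g (x + (real l / real N) *\<^sub>R z))"
    proof (cases "x \<in> K")
      case True
      let ?h = "\<lambda>l. U (x + (real l / real N) *\<^sub>R z)"
      have "U (x + z) - U x = (\<Sum>l<N. ?h (Suc l) - ?h l)"
        using \<open>N > 0\<close> by (subst sum_lessThan_telescope) simp
      then have "ennreal \<bar>U (x + z) - U x\<bar> \<le> ennreal (\<Sum>l<N. \<bar>?h (Suc l) - ?h l\<bar>)"
        by (simp only: ennreal_leI sum_abs)
      also have "\<dots> = (\<Sum>l<N. ennreal \<bar>?h (Suc l) - ?h l\<bar>)"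
        by (rule sum_ennreal[symmetric]) simp
      also have "\<dots> \<le> (\<Sum>l<N. g (x + (real l / real N) *\<^sub>R z))"
        using True by (intro sum_mono step) (auto simp: field_simps)
      finally show ?thesis using True by simp
    qed simp
  qed
  also have "\<dots> = (\<Sum>l<N. (\<integral>\<^sup>+x. g x \<partial>lborel))"
    by (subst nn_integral_sum) (auto intro!: sum.cong simp: nn_integral_lborel_translate)
  finally show ?thesis by simp
qed

text \<open>A step of size at most \<open>\<epsilon>\<close> changes the function only inside the
  cubes of radius \<open>(R + 1) * \<epsilon>\<close> around counted jumps. Integrating the
  indicators of these cubes turns the number of jumps into a volume, once for each of the
  \<open>N\<close> steps.\<close>

lemma shift_estimate_discrete:
  fixes \<Omega> :: "(real ^ 'n) set"
  defines "u' \<equiv> \<lambda>T C k\<^sub>0 \<epsilon> u. interpolation \<epsilon> (lattice_extension T C k\<^sub>0 \<epsilon> \<Omega> u)"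
  assumes R: "connecting_radius T C P k\<^sub>0 R" and "\<epsilon> > 0" "bounded \<Omega>" "N > 0"
    and u: "\<And>k. k \<in> lattice_points \<epsilon> \<Omega> \<Longrightarrow> u k \<in> {1, -1}"
    and z: "\<And>i. \<bar>z $ i\<bar> \<le> real N * \<epsilon>"
    and deep: "\<And>x t q. \<lbrakk>x \<in> K; 0 \<le> t; t \<le> 1; \<And>i. \<bar>q $ i - (x + t *\<^sub>R z) $ i\<bar> \<le> (R + 1) * \<epsilon>\<rbrakk> \<Longrightarrow> q \<in> \<Omega>"
  shows "(\<integral>\<^sup>+x\<in>K. ennreal \<bar>u' T C k\<^sub>0 \<epsilon> u (x + z) - u' T C k\<^sub>0 \<epsilon> u x\<bar> \<partial>lborel)
     \<le> ennreal (real N * (2 * real (card (jumps C P \<epsilon> \<Omega> u)) * (2 * ((R + 1) * \<epsilon>)) ^ CARD('n)))"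
proof -
  let ?U = "u' T C k\<^sub>0 \<epsilon> u" and ?J = "jumps C P \<epsilon> \<Omega> u" and ?r = "(R + 1) * \<epsilon>"
  define Q where "Q k = cbox (\<epsilon> *\<^sub>R lattice_vec k - ?r *\<^sub>R 1) (\<epsilon> *\<^sub>R lattice_vec k + ?r *\<^sub>R (1 :: real ^ 'n))" for k
  \<comment> \<open>The factor \<open>2\<close> is the largest difference of two spins. One cube
    containing the point already makes the sum at least \<open>1\<close>; overlaps only increase
    it.\<close>
  define g where "g x = 2 * (\<Sum>e\<in>?J. indicator (Q (fst e)) x :: ennreal)" for x
  have r: "?r \<ge> 0" using R \<open>\<epsilon> > 0\<close> by (simp add: connecting_radius_def)
  have fin: "finite ?J" using assms finite_jumps by blast
  have Q[measurable]: "Q k \<in> sets borel" for k by (simp add: Q_def)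
  have g[measurable]: "g \<in> borel_measurable borel"
    unfolding g_def by measurable
  have U: "?U x \<in> {1, -1}" for x
    using u by (auto simp: u'_def interpolation_cell lattice_extension_def)
  have "(\<integral>\<^sup>+x\<in>K. ennreal \<bar>?U (x + z) - ?U x\<bar> \<partial>lborel) \<le> of_nat N * (\<integral>\<^sup>+x. g x \<partial>lborel)"
  proof (rule shift_estimate_chain[OF g \<open>N > 0\<close>])
    fix x :: "real ^ 'n" and t s :: real
    assume x: "x \<in> K" "0 \<le> t" "t \<le> 1" and s: "s = t + 1 / real N"
    let ?x = "x + t *\<^sub>R z" and ?y = "x + s *\<^sub>R z"
    have diff: "\<bar>?U ?y - ?U ?x\<bar> \<le> 2" using U[of ?y] U[of ?x] by auto
    show "ennreal \<bar>?U ?y - ?U ?x\<bar> \<le> g ?x"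
    proof (cases "?U ?y = ?U ?x")
      case False
      have near: "\<bar>?y $ i - ?x $ i\<bar> \<le> \<epsilon>" for i
      proof -
        have "?y $ i - ?x $ i = z $ i / real N" by (simp add: s distrib_right)
        moreover have "\<bar>z $ i / real N\<bar> \<le> \<epsilon>"
          using z[of i] \<open>N > 0\<close> by (simp add: abs_divide field_simps)
        ultimately show ?thesis by (simp only:)
      qed
      obtain k k' where k: "(k, k') \<in> ?J" "\<And>i. \<bar>?x $ i - (\<epsilon> *\<^sub>R lattice_vec k) $ i\<bar> \<le> ?r"
        using near_jump[OF R \<open>\<epsilon> > 0\<close> near deep[OF x]] False unfolding u'_def by blast
      then have "?x \<in> Q k" unfolding Q_def mem_cube by blast
      then have "(1 :: ennreal) \<le> indicator (Q (fst (k, k'))) ?x" by simp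
      also have "\<dots> \<le> (\<Sum>e\<in>?J. indicator (Q (fst e)) ?x)"
        using k(1) _ fin by (rule member_le_sum) simp
      finally have "2 * 1 \<le> g ?x" unfolding g_def by (rule mult_left_mono) simp
      moreover have "ennreal \<bar>?U ?y - ?U ?x\<bar> \<le> 2"
        using diff by (metis ennreal_leI ennreal_numeral zero_le_numeral)
      ultimately show ?thesis by simp
    qed simp
  qed
  also have "(\<integral>\<^sup>+x. g x \<partial>lborel) = 2 * (\<Sum>e\<in>?J. emeasure lborel (Q (fst e)))"
    unfolding g_def by (simp add: nn_integral_cmult nn_integral_sum)
  also have "\<dots> = 2 * (of_nat (card ?J) * ennreal ((2 * ?r) ^ CARD('n)))"
    unfolding Q_def emeasure_cube[OF r] by simp
  also have "of_nat N * \<dots> = ennreal (real N * (2 * real (card ?J) * (2 * ?r) ^ CARD('n)))"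
    using r by (simp add: ennreal_mult ennreal_of_nat_eq_real_of_nat mult.assoc)
  finally show ?thesis .
qed

text \<open>At most \<open>B / \<epsilon>^(d-1)\<close> jumps, each with a cube of volume of order
  \<open>\<epsilon>^d\<close>, give order \<open>\<epsilon>\<close> for one step; about
  \<open>norm z / \<epsilon> + 1\<close> steps give \<open>norm z + \<epsilon>\<close>. Only
  \<open>\<rho>\<close> and the threshold for \<open>j\<close> depend on \<open>K\<close>. That
  \<open>A\<close> does not is what later bounds the variation.\<close>

lemma shift_estimate:
  fixes \<Omega> :: "(real ^ 'n) set" and T :: nat and \<epsilon> :: "nat \<Rightarrow> real"
  defines "U \<equiv> \<lambda>T C k\<^sub>0 u j. interpolation (\<epsilon> j) (lattice_extension T C k\<^sub>0 (\<epsilon> j) \<Omega> (u j))"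
  assumes R: "connecting_radius T C P k\<^sub>0 R" and "open \<Omega>" "bounded \<Omega>"
    and \<epsilon>: "\<And>j. \<epsilon> j > 0" "\<epsilon> \<longlonglongrightarrow> 0"
    and u: "\<And>j k. k \<in> lattice_points (\<epsilon> j) \<Omega> \<Longrightarrow> u j k \<in> {1, -1}"
    and B: "\<And>j. \<epsilon> j ^ (CARD('n) - 1) * real (card (jumps C P (\<epsilon> j) \<Omega> (u j))) \<le> B"
  obtains A where "A \<ge> 0"
    "\<And>K. compact K \<Longrightarrow> K \<subseteq> \<Omega> \<Longrightarrow> \<exists>\<rho>>0. \<forall>\<^sub>F j in sequentially. \<forall>z. norm z \<le> \<rho> \<longrightarrow>
       (\<integral>\<^sup>+x\<in>K. ennreal \<bar>U T C k\<^sub>0 u j (x + z) - U T C k\<^sub>0 u j x\<bar> \<partial>lborel) \<le> ennreal (A * (norm z + \<epsilon> j))"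
proof -
  \<comment> \<open>In the factor \<open>4\<close>, one \<open>2\<close> is the size of a spin jump
    and the other comes from
    \<open>real N * \<epsilon> j \<le> 2 * (norm z + \<epsilon> j)\<close>.\<close>
  define A where "A = 4 * B * (2 * (R + 1)) ^ CARD('n)"
  have "R \<ge> 0" using R by (simp add: connecting_radius_def)
  have "0 \<le> \<epsilon> 0 ^ (CARD('n) - 1) * real (card (jumps C P (\<epsilon> 0) \<Omega> (u 0)))"
    using \<epsilon>(1)[of 0] by simp
  with B[of 0] have "B \<ge> 0" by linarith
  with \<open>R \<ge> 0\<close> have "A \<ge> 0" by (simp add: A_def)
  have "\<exists>\<rho>>0. \<forall>\<^sub>F j in sequentially. \<forall>z. norm z \<le> \<rho> \<longrightarrow>
       (\<integral>\<^sup>+x\<in>K. ennreal \<bar>U T C k\<^sub>0 u j (x + z) - U T C k\<^sub>0 u j x\<bar> \<partial>lborel) \<le> ennreal (A * (norm z + \<epsilon> j))"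
    if K: "compact K" "K \<subseteq> \<Omega>" for K
  proof -
  obtain e where e: "e > 0" "(\<Union>x\<in>K. cball x e) \<subseteq> \<Omega>"
    using compact_subset_open_imp_cball_epsilon_subset[OF K(1) \<open>open \<Omega>\<close> K(2)] by blast
  \<comment> \<open>The margin \<open>e\<close> around \<open>K\<close> is split in two: half for
    the segment towards \<open>x + z\<close>, half for the cubes. The factor \<open>CARD('n)\<close>
    passes from the maximum norm to the Euclidean norm.\<close>
  have "(\<lambda>j. CARD('n) * ((R + 1) * \<epsilon> j)) \<longlonglongrightarrow> CARD('n) * ((R + 1) * 0)"
    by (intro tendsto_intros \<epsilon>)
  from order_tendstoD(2)[OF this, of "e / 2"]
  have ev: "\<forall>\<^sub>F j in sequentially. CARD('n) * ((R + 1) * \<epsilon> j) < e / 2"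
    using e(1) by simp
  have "\<forall>\<^sub>F j in sequentially. \<forall>z. norm z \<le> e / 2 \<longrightarrow>
       (\<integral>\<^sup>+x\<in>K. ennreal \<bar>U T C k\<^sub>0 u j (x + z) - U T C k\<^sub>0 u j x\<bar> \<partial>lborel) \<le> ennreal (A * (norm z + \<epsilon> j))"
    using ev
  proof eventually_elim
    case (elim j)
    show ?case
    proof (intro allI impI)
      fix z :: "real ^ 'n" assume z: "norm z \<le> e / 2"
      \<comment> \<open>The \<open>+ 1\<close> makes \<open>N\<close> positive also for
        \<open>z = 0\<close>; together with the ceiling it exceeds
        \<open>norm z / \<epsilon> j\<close> by at most \<open>2\<close>.\<close>
      define N where "N = nat \<lceil>norm z / \<epsilon> j\<rceil> + 1"
      have Nlo: "norm z / \<epsilon> j \<le> real N" and Nhi: "real N \<le> norm z / \<epsilon> j + 2"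
        using \<epsilon>(1)[of j] unfolding N_def by simp_all linarith+
      let ?J = "real (card (jumps C P (\<epsilon> j) \<Omega> (u j)))"
      \<comment> \<open>One power of \<open>\<epsilon> j\<close> is separated to be absorbed by
        \<open>N\<close>; the remaining ones match the scaling of the jump count in
        \<open>B\<close>.\<close>
      have p: "(2 * ((R + 1) * \<epsilon> j)) ^ CARD('n) = (2 * (R + 1)) ^ CARD('n) * (\<epsilon> j * \<epsilon> j ^ (CARD('n) - 1))"
      proof -
        have "(2 * ((R + 1) * \<epsilon> j)) ^ CARD('n) = ((2 * (R + 1)) * \<epsilon> j) ^ CARD('n)"
          by (simp only: mult.assoc)
        also have "\<dots> = (2 * (R + 1)) ^ CARD('n) * \<epsilon> j ^ Suc (CARD('n) - 1)"
          by (simp only: power_mult_distrib) simp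
        finally show ?thesis by (simp only: power_Suc)
      qed
      have "(\<integral>\<^sup>+x\<in>K. ennreal \<bar>U T C k\<^sub>0 u j (x + z) - U T C k\<^sub>0 u j x\<bar> \<partial>lborel) \<le>
          ennreal (real N * (2 * ?J * (2 * ((R + 1) * \<epsilon> j)) ^ CARD('n)))"
        unfolding U_def
      proof (rule shift_estimate_discrete[OF R \<epsilon>(1) \<open>bounded \<Omega>\<close>])
        show "\<bar>z $ i\<bar> \<le> real N * \<epsilon> j" for i
          using Nlo component_le_norm_cart[of z i] \<epsilon>(1)[of j] by (simp add: field_simps)
        fix x q :: "real ^ 'n" and t :: real
        assume x: "x \<in> K" "0 \<le> t" "t \<le> 1" and q: "\<And>i. \<bar>q $ i - (x + t *\<^sub>R z) $ i\<bar> \<le> (R + 1) * \<epsilon> j"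
        have "norm (q - (x + t *\<^sub>R z)) \<le> (\<Sum>i\<in>UNIV. \<bar>(q - (x + t *\<^sub>R z)) $ i\<bar>)"
          by (rule norm_le_l1_cart)
        also have "\<dots> \<le> (\<Sum>i\<in>(UNIV :: 'n set). (R + 1) * \<epsilon> j)"
          using q by (intro sum_mono) simp
        finally have 1: "norm (q - (x + t *\<^sub>R z)) \<le> e / 2" using elim by simp
        have 2: "norm (t *\<^sub>R z) \<le> e / 2"
          using z x mult_left_le_one_le[of "norm z" t] by simp
        have "norm (q - x) \<le> norm (q - (x + t *\<^sub>R z)) + norm (t *\<^sub>R z)"
          using norm_triangle_ineq[of "q - (x + t *\<^sub>R z)" "t *\<^sub>R z"] by simp
        with 1 2 have "q \<in> cball x e" by (simp add: dist_norm norm_minus_commute)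
        with e(2) x(1) show "q \<in> \<Omega>" by blast
      qed (use u in \<open>auto simp: N_def\<close>)
      also have "real N * (2 * ?J * (2 * ((R + 1) * \<epsilon> j)) ^ CARD('n)) =
          (real N * \<epsilon> j) * (\<epsilon> j ^ (CARD('n) - 1) * ?J) * (2 * (2 * (R + 1)) ^ CARD('n))"
        unfolding p by (simp only: mult_ac)
      also have "\<dots> \<le> (2 * (norm z + \<epsilon> j)) * B * (2 * (2 * (R + 1)) ^ CARD('n))"
      proof (rule mult_right_mono[OF mult_mono[OF _ B]])
        show "real N * \<epsilon> j \<le> 2 * (norm z + \<epsilon> j)"
          using Nhi \<epsilon>(1)[of j] by (simp add: field_simps) (smt (verit) norm_ge_zero)
      qed (use \<open>R \<ge> 0\<close> \<epsilon>(1)[of j] in \<open>auto intro!: add_nonneg_nonneg less_imp_le\<close>)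
      also have "\<dots> = A * (norm z + \<epsilon> j)" by (simp add: A_def)
      finally show "(\<integral>\<^sup>+x\<in>K. ennreal \<bar>U T C k\<^sub>0 u j (x + z) - U T C k\<^sub>0 u j x\<bar> \<partial>lborel) \<le> ennreal (A * (norm z + \<epsilon> j))"
        by (simp add: ennreal_leI)
    qed
  qed
  with e(1) show ?thesis by (intro exI[of _ "e / 2"]) auto
  qed
  with \<open>A \<ge> 0\<close> show ?thesis by (rule that)
qed

section \<open>Averages over cells\<close>

text \<open>With values in \<open>ennreal\<close> this is meaningful for all Borel functions, so
  triangle inequalities and limits can be handled before integrability is established.\<close>

definition L1_dist :: "(real ^ 'n) set \<Rightarrow> (real ^ 'n \<Rightarrow> real) \<Rightarrow> (real ^ 'n \<Rightarrow> real) \<Rightarrow> ennreal" where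
  "L1_dist K f g = (\<integral>\<^sup>+x\<in>K. ennreal \<bar>f x - g x\<bar> \<partial>lborel)"

lemma L1_dist_commute: "L1_dist K f g = L1_dist K g f"
  by (simp add: L1_dist_def abs_minus_commute)

lemma L1_dist_triangle:
  assumes [measurable]: "K \<in> sets borel" "f \<in> borel_measurable borel" "g \<in> borel_measurable borel"
    "h \<in> borel_measurable borel"
  shows "L1_dist K f h \<le> L1_dist K f g + L1_dist K g h"
proof -
  have "L1_dist K f h \<le> (\<integral>\<^sup>+x. ennreal \<bar>f x - g x\<bar> * indicator K x + ennreal \<bar>g x - h x\<bar> * indicator K x \<partial>lborel)"
    unfolding L1_dist_def
    by (intro nn_integral_mono)
       (auto split: split_indicator simp flip: ennreal_plus intro!: ennreal_leI)
  also have "\<dots> = L1_dist K f g + L1_dist K g h"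
    unfolding L1_dist_def by (rule nn_integral_add) auto
  finally show ?thesis .
qed

text \<open>Dominated convergence: the integrand is at most \<open>2\<close> on \<open>K\<close>,
  which has finite measure.\<close>

lemma L1_dist_tendsto_0:
  fixes g :: "real ^ 'n \<Rightarrow> real"
  assumes [measurable]: "\<And>j. f j \<in> borel_measurable borel" "g \<in> borel_measurable borel"
    and K: "compact K"
    and bound: "\<And>j x. \<bar>f j x\<bar> \<le> 1" "\<And>x. \<bar>g x\<bar> \<le> 1"
    and lim: "AE x in lborel. x \<in> K \<longrightarrow> (\<lambda>j. f j x) \<longlonglongrightarrow> g x"
  shows "(\<lambda>j. L1_dist K (f j) g) \<longlonglongrightarrow> 0"
proof -
  have [measurable]: "K \<in> sets borel" using K by (simp add: borel_compact)
  have "(\<lambda>j. L1_dist K (f j) g) \<longlonglongrightarrow> (\<integral>\<^sup>+(x :: real ^ 'n). 0 \<partial>lborel)"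
    unfolding L1_dist_def
  proof (rule nn_integral_dominated_convergence[where u = "\<lambda>j x. ennreal \<bar>f j x - g x\<bar> * indicator K x" and u' = "\<lambda>_. 0" and w = "\<lambda>x. 2 * indicator K x"])
    show "AE x in lborel. ennreal \<bar>f j x - g x\<bar> * indicator K x \<le> 2 * indicator K x" for j
    proof (intro AE_I2)
      fix x
      have "\<bar>f j x - g x\<bar> \<le> 2" using bound(1)[of j x] bound(2)[of x] by linarith
      then have "ennreal \<bar>f j x - g x\<bar> \<le> 2"
        by (metis ennreal_leI ennreal_numeral zero_le_numeral)
      then show "ennreal \<bar>f j x - g x\<bar> * indicator K x \<le> 2 * indicator K x"
        by (intro mult_right_mono) auto
    qed
    show "(\<integral>\<^sup>+x. 2 * indicator K x \<partial>lborel) < \<infinity>"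
      using emeasure_compact_finite[OF K] by (simp add: nn_integral_cmult_indicator ennreal_mult_less_top)
    show "AE x in lborel. (\<lambda>j. ennreal \<bar>f j x - g x\<bar> * indicator K x) \<longlonglongrightarrow> 0"
      using lim
    proof eventually_elim
      case (elim x)
      show ?case
      proof (cases "x \<in> K")
        case True
        then have "(\<lambda>j. \<bar>f j x - g x\<bar>) \<longlonglongrightarrow> 0"
          using elim LIM_zero tendsto_rabs_zero by blast
        then have "(\<lambda>j. ennreal \<bar>f j x - g x\<bar>) \<longlonglongrightarrow> ennreal 0"
          by (rule tendsto_ennrealI)
        with True show ?thesis by simp
      qed simp
    qed
  qed auto
  then show ?thesis by simp
qed

section \<open>Averages over half-open cells of side \<open>\<delta>\<close>\<close>

lemma cell_eq_iff:
  assumes "\<delta> > 0"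
  shows "cell \<delta> x = k \<longleftrightarrow> (\<forall>i. \<delta> * real_of_int (k $ i) \<le> x $ i \<and> x $ i < \<delta> * (real_of_int (k $ i) + 1))"
  using assms by (auto simp: cell_def vec_eq_iff floor_eq_iff field_simps)

lemma cell_set_measurable [measurable]: "{y :: real ^ 'n. cell \<delta> y = k} \<in> sets borel"
proof -
  have "cell \<delta> -` {k} \<inter> space borel \<in> sets (borel :: (real ^ 'n) measure)"
    by (rule measurable_sets[OF cell_measurable]) simp
  then show ?thesis by (simp add: vimage_def)
qed

text \<open>The half-open cube lies between the open and the closed box with the same corners, which
  have equal volume.\<close>

lemma emeasure_cell:
  assumes "\<delta> > 0"
  shows "emeasure lborel {y :: real ^ 'n. cell \<delta> y = k} = ennreal (\<delta> ^ CARD('n))"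
proof -
  define a b where "a = \<delta> *\<^sub>R lattice_vec k" and "b = \<delta> *\<^sub>R lattice_vec k + \<delta> *\<^sub>R (1 :: real ^ 'n)"
  have inner: "(b - a) \<bullet> e = \<delta>" "a \<bullet> e \<le> b \<bullet> e" if "e \<in> Basis" for e
    using that assms by (auto simp: a_def b_def Basis_vec_def cart_eq_inner_axis[symmetric])
  have "(\<Prod>e\<in>Basis. (b - a) \<bullet> e) = (\<Prod>e\<in>(Basis :: (real ^ 'n) set). \<delta>)"
    by (rule prod.cong) (auto simp: inner)
  then have "emeasure lborel (box a b) = ennreal (\<delta> ^ CARD('n))"
    "emeasure lborel (cbox a b) = ennreal (\<delta> ^ CARD('n))"
    by (subst emeasure_lborel_box emeasure_lborel_cbox; simp add: inner)+
  moreover have "box a b \<subseteq> {y. cell \<delta> y = k}" "{y. cell \<delta> y = k} \<subseteq> cbox a b"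
    by (auto simp: cell_eq_iff[OF assms] mem_box_cart a_def b_def lattice_vec_def algebra_simps less_imp_le)
  ultimately show ?thesis
    by (intro antisym) (metis emeasure_mono sets_lborel cell_set_measurable borel_closed closed_cbox borel_open open_box)+
qed

definition cell_average :: "real \<Rightarrow> (real ^ 'n \<Rightarrow> real) \<Rightarrow> int ^ 'n \<Rightarrow> real" where
  "cell_average \<delta> f k = (LINT y:{y. cell \<delta> y = k}|lborel. f y) / \<delta> ^ CARD('n)"

lemma cell_integrable:
  fixes f :: "real ^ 'n \<Rightarrow> real" and \<delta> :: real
  assumes "\<delta> > 0" and [measurable]: "f \<in> borel_measurable borel" and "\<And>x. \<bar>f x\<bar> \<le> B"
  shows "set_integrable lborel {y. cell \<delta> y = k} f"
  unfolding set_integrable_def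
  by (rule integrableI_bounded_set_indicator[where B = B])
     (use assms in \<open>auto simp: emeasure_cell\<close>)

lemma cell_integral_const:
  assumes "\<delta> > 0"
  shows "(LINT y:{y :: real ^ 'n. cell \<delta> y = k}|lborel. c) = c * \<delta> ^ CARD('n)"
  using emeasure_cell[OF assms, of k] assms
  by (simp add: set_lebesgue_integral_def measure_def)

lemma abs_cell_average_le_1:
  fixes f :: "real ^ 'n \<Rightarrow> real" and \<delta> :: real
  assumes "\<delta> > 0" and [measurable]: "f \<in> borel_measurable borel" and "\<And>x. \<bar>f x\<bar> \<le> 1"
  shows "\<bar>cell_average \<delta> f k\<bar> \<le> 1"
proof -
  let ?Q = "{y. cell \<delta> y = k}"
  have "\<bar>LINT y:?Q|lborel. f y\<bar> \<le> (LINT y:?Q|lborel. \<bar>f y\<bar>)"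
    using set_integral_norm_bound[OF cell_integrable[OF assms], of k] by simp
  also have "\<dots> \<le> (LINT y:?Q|lborel. 1)"
    by (intro set_integral_mono cell_integrable[where B = 1]) (auto simp: assms)
  also have "\<dots> = \<delta> ^ CARD('n)"
    by (simp add: cell_integral_const assms)
  finally show ?thesis
    using assms(1) by (simp add: cell_average_def abs_divide)
qed

text \<open>The deviation is the mean of \<open>f x - f y\<close> over the cell of \<open>x\<close>,
  and every such \<open>y - x\<close> lies in the cube of radius \<open>\<delta>\<close> about
  \<open>0\<close>. Enlarging the cell to this fixed range of \<open>z\<close> removes the
  dependence on the position of \<open>x\<close>, as Fubini requires.\<close>

lemma deviation_from_cell_average:
  fixes f :: "real ^ 'n \<Rightarrow> real" and \<delta> :: real
  assumes "\<delta> > 0" and [measurable]: "f \<in> borel_measurable borel" and "\<And>x. \<bar>f x\<bar> \<le> 1"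
  shows "ennreal \<bar>f x - cell_average \<delta> f (cell \<delta> x)\<bar> \<le>
     ennreal (1 / \<delta> ^ CARD('n)) * (\<integral>\<^sup>+z\<in>cbox (0 - \<delta> *\<^sub>R 1) (0 + \<delta> *\<^sub>R 1). ennreal \<bar>f (x + z) - f x\<bar> \<partial>lborel)"
proof -
  let ?Q = "{y. cell \<delta> y = cell \<delta> x}" and ?D = "\<delta> ^ CARD('n)"
  have int: "set_integrable lborel ?Q (\<lambda>y. f x - f y)"
  proof (rule cell_integrable[where B = 2])
    show "\<bar>f x - f y\<bar> \<le> 2" for y using assms(3)[of x] assms(3)[of y] by linarith
  qed (use assms in auto)
  have "f x - cell_average \<delta> f (cell \<delta> x) = (LINT y:?Q|lborel. f x - f y) / ?D"
    using assms(1)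
    by (subst set_integral_diff(2)[OF cell_integrable[where B = "\<bar>f x\<bar>"] cell_integrable[where B = 1]])
       (auto simp: assms cell_integral_const cell_average_def diff_divide_distrib less_imp_neq[OF assms(1), symmetric])
  then have "\<bar>f x - cell_average \<delta> f (cell \<delta> x)\<bar> \<le> 1 / ?D * (LINT y:?Q|lborel. \<bar>f x - f y\<bar>)"
    using set_integral_norm_bound[OF int] assms(1) by (simp add: abs_divide divide_right_mono)
  then have "ennreal \<bar>f x - cell_average \<delta> f (cell \<delta> x)\<bar> \<le> ennreal (1 / ?D) * ennreal (LINT y:?Q|lborel. \<bar>f x - f y\<bar>)"
    using assms(1) by (subst ennreal_mult[symmetric]) (auto intro!: ennreal_leI simp: set_lebesgue_integral_def)
  also have "ennreal (LINT y:?Q|lborel. \<bar>f x - f y\<bar>) = (\<integral>\<^sup>+y. ennreal (indicator ?Q y *\<^sub>R \<bar>f x - f y\<bar>) \<partial>lborel)"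
    unfolding set_lebesgue_integral_def
    using set_integrable_abs[OF int] unfolding set_integrable_def
    by (intro nn_integral_eq_integral[symmetric]) auto
  also have "\<dots> = (\<integral>\<^sup>+z. ennreal (indicator ?Q (z + x) *\<^sub>R \<bar>f x - f (z + x)\<bar>) \<partial>lborel)"
    by (rule nn_integral_lborel_translate[symmetric]) measurable
  also have "\<dots> \<le> (\<integral>\<^sup>+z\<in>cbox (0 - \<delta> *\<^sub>R 1) (0 + \<delta> *\<^sub>R 1). ennreal \<bar>f (x + z) - f x\<bar> \<partial>lborel)"
  proof (intro nn_integral_mono)
    fix z
    have "\<bar>z $ i\<bar> \<le> \<delta>" if "z + x \<in> ?Q" for i
    proof -
      define m where "m = \<delta> * real_of_int (cell \<delta> x $ i)"
      have "m \<le> x $ i" "x $ i < m + \<delta>" "m \<le> (z + x) $ i" "(z + x) $ i < m + \<delta>"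
        using that cell_eq_iff[OF assms(1), of x "cell \<delta> x"] cell_eq_iff[OF assms(1), of "z + x" "cell \<delta> x"]
        by (auto simp: m_def algebra_simps)
      then show ?thesis by (simp add: abs_le_iff)
    qed
    then have "z \<in> cbox (0 - \<delta> *\<^sub>R 1) (0 + \<delta> *\<^sub>R 1)" if "z + x \<in> ?Q"
      using that unfolding mem_cube by simp
    then show "ennreal (indicator ?Q (z + x) *\<^sub>R \<bar>f x - f (z + x)\<bar>) \<le>
        ennreal \<bar>f (x + z) - f x\<bar> * indicator (cbox (0 - \<delta> *\<^sub>R 1) (0 + \<delta> *\<^sub>R 1)) z"
      by (cases "z + x \<in> ?Q") (simp_all add: add.commute abs_minus_commute)
  qed
  finally show ?thesis by (simp add: mult_left_mono)
qed

text \<open>Integrate the pointwise deviation over \<open>K\<close> and exchange the integrals: each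
  translation \<open>z\<close> in the cube contributes at most \<open>M\<close>. The constant is the
  ratio of the cube volume \<open>(2 * \<delta>)^d\<close> to the cell volume
  \<open>\<delta>^d\<close>; on the cube \<open>norm z\<close> is at most
  \<open>CARD('n) * \<delta>\<close>.\<close>

lemma L1_dist_cell_average:
  fixes f :: "real ^ 'n \<Rightarrow> real" and \<delta> :: real
  assumes \<delta>: "\<delta> > 0" and [measurable]: "f \<in> borel_measurable borel" and bnd: "\<And>x. \<bar>f x\<bar> \<le> 1"
    and [measurable]: "K \<in> sets borel"
    and shift: "\<And>z. norm z \<le> CARD('n) * \<delta> \<Longrightarrow> (\<integral>\<^sup>+x\<in>K. ennreal \<bar>f (x + z) - f x\<bar> \<partial>lborel) \<le> M"
  shows "L1_dist K f (interpolation \<delta> (cell_average \<delta> f)) \<le> 2 ^ CARD('n) * M"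
proof -
  let ?Z = "cbox (0 - \<delta> *\<^sub>R 1) (0 + \<delta> *\<^sub>R (1 :: real ^ 'n))" and ?c = "ennreal (1 / \<delta> ^ CARD('n))"
  have "L1_dist K f (interpolation \<delta> (cell_average \<delta> f)) \<le>
     (\<integral>\<^sup>+x. \<integral>\<^sup>+z. ?c * (ennreal \<bar>f (x + z) - f x\<bar> * indicator ?Z z * indicator K x) \<partial>lborel \<partial>lborel)"
    unfolding L1_dist_def interpolation_cell
  proof (intro nn_integral_mono)
    fix x
    show "ennreal \<bar>f x - cell_average \<delta> f (cell \<delta> x)\<bar> * indicator K x \<le>
       (\<integral>\<^sup>+z. ?c * (ennreal \<bar>f (x + z) - f x\<bar> * indicator ?Z z * indicator K x) \<partial>lborel)"
      using deviation_from_cell_average[OF \<delta> assms(2) bnd, of x]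
      by (simp add: nn_integral_cmult split: split_indicator)
  qed
  also have "\<dots> = (\<integral>\<^sup>+z. \<integral>\<^sup>+x. ?c * (ennreal \<bar>f (x + z) - f x\<bar> * indicator ?Z z * indicator K x) \<partial>lborel \<partial>lborel)"
    by (rule lborel_pair.Fubini') measurable
  also have "\<dots> = (\<integral>\<^sup>+z. ?c * ((\<integral>\<^sup>+x\<in>K. ennreal \<bar>f (x + z) - f x\<bar> \<partial>lborel) * indicator ?Z z) \<partial>lborel)"
    by (intro nn_integral_cong) (simp add: nn_integral_cmult split: split_indicator)
  also have "\<dots> \<le> (\<integral>\<^sup>+z. (?c * M) * indicator ?Z z \<partial>lborel)"
  proof (intro nn_integral_mono)
    fix z
    have "norm z \<le> CARD('n) * \<delta>" if "z \<in> ?Z"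
    proof -
      have "norm z \<le> (\<Sum>i\<in>UNIV. \<bar>z $ i\<bar>)" by (rule norm_le_l1_cart)
      also have "\<dots> \<le> (\<Sum>i\<in>(UNIV :: 'n set). \<delta>)"
        using that unfolding mem_cube by (intro sum_mono) simp
      finally show ?thesis by simp
    qed
    with shift[of z] show "?c * ((\<integral>\<^sup>+x\<in>K. ennreal \<bar>f (x + z) - f x\<bar> \<partial>lborel) * indicator ?Z z) \<le> (?c * M) * indicator ?Z z"
      by (auto split: split_indicator intro: mult_left_mono)
  qed
  also have "\<dots> = ?c * M * ennreal ((2 * \<delta>) ^ CARD('n))"
    using \<delta> by (subst nn_integral_cmult_indicator) (simp_all add: emeasure_cube del: diff_0 add_0)
  also have "\<dots> = ennreal (1 / \<delta> ^ CARD('n) * (2 * \<delta>) ^ CARD('n)) * M"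
    using \<delta> by (subst ennreal_mult) (auto simp: mult_ac)
  also have "1 / \<delta> ^ CARD('n) * (2 * \<delta>) ^ CARD('n) = 2 ^ CARD('n)"
    using \<delta> by (simp add: power_mult_distrib)
  finally show ?thesis by (simp add: ennreal_power[symmetric])
qed

section \<open>Compactness\<close>

text \<open>An iterated limit: the scale \<open>n\<close> is fixed first so that \<open>y n\<close>
  is small, and only then does \<open>j\<close> tend to infinity.\<close>

lemma ennreal_tendsto_0_squeeze:
  fixes X :: "nat \<Rightarrow> ennreal"
  assumes le: "\<And>n. n \<ge> n\<^sub>0 \<Longrightarrow> \<forall>\<^sub>F j in sequentially. X j \<le> Y n j"
    and Y: "\<And>n. n \<ge> n\<^sub>0 \<Longrightarrow> Y n \<longlonglongrightarrow> y n" and y: "y \<longlonglongrightarrow> 0"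
  shows "X \<longlonglongrightarrow> 0"
proof (rule order_tendstoI)
  fix a :: ennreal assume "0 < a"
  then have "\<forall>\<^sub>F n in sequentially. y n < a \<and> n \<ge> n\<^sub>0"
    using order_tendstoD(2)[OF y] eventually_ge_at_top by (auto intro: eventually_conj)
  then obtain n where n: "y n < a" "n \<ge> n\<^sub>0"
    by (auto simp: eventually_sequentially)
  show "\<forall>\<^sub>F j in sequentially. X j < a"
    using le[OF n(2)] order_tendstoD(2)[OF Y[OF n(2)] n(1)] by eventually_elim auto
qed simp

text \<open>The sum of the absolute increments has a finite integral over \<open>K\<close>, hence is
  finite almost everywhere; there the telescoping series converges absolutely.\<close>

lemma AE_convergent_if_L1_summable:
  fixes h :: "nat \<Rightarrow> real ^ 'n \<Rightarrow> real"
  assumes [measurable]: "\<And>n. h n \<in> borel_measurable borel" "K \<in> sets borel"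
    and le: "\<And>n. n \<ge> n\<^sub>0 \<Longrightarrow> L1_dist K (h (Suc n)) (h n) \<le> ennreal (b n)"
    and b: "summable b" "\<And>n. b n \<ge> 0"
  shows "AE x in lborel. x \<in> K \<longrightarrow> convergent (\<lambda>n. h n x)"
proof -
  define g where "g x = (\<Sum>n. ennreal \<bar>h (Suc (n + n\<^sub>0)) x - h (n + n\<^sub>0) x\<bar> * indicator K x)" for x
  have [measurable]: "g \<in> borel_measurable borel" unfolding g_def by measurable
  have "(\<integral>\<^sup>+x. g x \<partial>lborel) = (\<Sum>n. L1_dist K (h (Suc (n + n\<^sub>0))) (h (n + n\<^sub>0)))"
    unfolding g_def L1_dist_def by (rule nn_integral_suminf) measurable
  also have "\<dots> \<le> (\<Sum>n. ennreal (b (n + n\<^sub>0)))"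
    by (intro suminf_le le) auto
  also have "\<dots> < \<infinity>"
  proof -
    have "(\<Sum>n. ennreal (b (n + n\<^sub>0))) \<noteq> top"
      using b summable_ignore_initial_segment[OF b(1)] by (intro ennreal_suminf_neq_top) auto
    then show ?thesis unfolding infinity_ennreal_def top.not_eq_extremum .
  qed
  finally have "AE x in lborel. g x \<noteq> \<infinity>"
    by (intro nn_integral_noteq_infinite) auto
  then show ?thesis
  proof eventually_elim
    case (elim x)
    show ?case
    proof
      assume "x \<in> K"
      with elim have "(\<Sum>n. ennreal \<bar>h (Suc (n + n\<^sub>0)) x - h (n + n\<^sub>0) x\<bar>) \<noteq> top"
        by (simp add: g_def)
      then have "summable (\<lambda>n. \<bar>h (Suc (n + n\<^sub>0)) x - h (n + n\<^sub>0) x\<bar>)"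
        by (rule summable_suminf_not_top[rotated]) simp
      then have "summable (\<lambda>n. h (Suc (n + n\<^sub>0)) x - h (n + n\<^sub>0) x)"
        by (rule summable_rabs_cancel)
      then obtain s where "(\<lambda>m. \<Sum>n<m. h (Suc (n + n\<^sub>0)) x - h (n + n\<^sub>0) x) \<longlonglongrightarrow> s"
        using summable_LIMSEQ by blast
      moreover have "(\<Sum>n<m. h (Suc (n + n\<^sub>0)) x - h (n + n\<^sub>0) x) = h (m + n\<^sub>0) x - h n\<^sub>0 x" for m
        using sum_lessThan_telescope[of "\<lambda>n. h (n + n\<^sub>0) x" m] by simp
      ultimately have "(\<lambda>m. h (m + n\<^sub>0) x - h n\<^sub>0 x) \<longlonglongrightarrow> s" by simp
      from tendsto_add[OF this tendsto_const[of "h n\<^sub>0 x"]]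
      have "(\<lambda>m. h (m + n\<^sub>0) x) \<longlonglongrightarrow> s + h n\<^sub>0 x" by simp
      from LIMSEQ_offset[OF this] show "convergent (\<lambda>n. h n x)"
        by (rule convergentI)
    qed
  qed
qed

text \<open>A Frechet-Kolmogorov type criterion: averages over dyadic cells converge along a diagonal
  subsequence, and the shift estimate bounds their distance to the functions themselves.\<close>

lemma L1_loc_compactness:
  fixes f :: "nat \<Rightarrow> real ^ 'n \<Rightarrow> real" and \<epsilon> :: "nat \<Rightarrow> real"
  assumes [measurable]: "\<And>j. f j \<in> borel_measurable borel" and bnd: "\<And>j x. \<bar>f j x\<bar> \<le> 1"
    and "A \<ge> 0" and \<epsilon>: "\<And>j. \<epsilon> j \<ge> 0" "\<epsilon> \<longlonglongrightarrow> 0"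
    and shift: "\<And>K. compact K \<Longrightarrow> K \<subseteq> \<Omega> \<Longrightarrow> \<exists>\<rho>>0. \<forall>\<^sub>F j in sequentially. \<forall>z. norm z \<le> \<rho> \<longrightarrow>
       (\<integral>\<^sup>+x\<in>K. ennreal \<bar>f j (x + z) - f j x\<bar> \<partial>lborel) \<le> ennreal (A * (norm z + \<epsilon> j))"
  obtains r w where "strict_mono (r :: nat \<Rightarrow> nat)" "w \<in> borel_measurable borel" "\<And>x. \<bar>w x\<bar> \<le> 1"
    "\<And>K. compact K \<Longrightarrow> K \<subseteq> \<Omega> \<Longrightarrow> (\<lambda>j. L1_dist K (f (r j)) w) \<longlonglongrightarrow> 0"
proof -
  \<comment> \<open>Geometric decay makes the error bounds \<open>q0\<close> summable, which is what
    almost everywhere convergence of the limits \<open>h n\<close> rests on.\<close>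
  define \<delta> :: "nat \<Rightarrow> real" where "\<delta> n = (1 / 2) ^ n" for n
  have \<delta>: "\<delta> n > 0" "\<delta> (Suc n) \<le> \<delta> n" for n by (simp_all add: \<delta>_def)
  have \<delta>0: "\<delta> \<longlonglongrightarrow> 0" unfolding \<delta>_def by (rule LIMSEQ_power_zero) simp
  define D where "D = real CARD('n)"
  have "\<bar>cell_average (\<delta> n) (f j) k\<bar> \<le> 1" for n j k
    by (intro abs_cell_average_le_1 \<delta> bnd) measurable
  then have avg_le: "norm (cell_average (\<delta> (fst p)) (f j) (snd p)) \<le> 1" for j p
    by simp
  \<comment> \<open>Pairs of a scale and a cell index form a countable set, so one diagonal
    extraction makes every average converge. The subsequence depends on no compact set.\<close>
  obtain r where r: "strict_mono (r :: nat \<Rightarrow> nat)"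
    and conv: "\<And>p. p \<in> UNIV \<Longrightarrow> \<exists>l. (\<lambda>j. cell_average (\<delta> (fst p)) (f (r j)) (snd p)) \<longlonglongrightarrow> l"
    by (rule function_convergent_subsequence[where S = UNIV and M = 1
          and f = "\<lambda>j p. cell_average (\<delta> (fst p)) (f j) (snd p)"]) (use avg_le in auto)
  define a where "a n k = lim (\<lambda>j. cell_average (\<delta> n) (f (r j)) k)" for n k
  have a: "(\<lambda>j. cell_average (\<delta> n) (f (r j)) k) \<longlonglongrightarrow> a n k" for n k
    using conv[of "(n, k)"] unfolding a_def fst_conv snd_conv convergent_LIMSEQ_iff[symmetric] convergent_def by simp
  define avg where "avg n j = interpolation (\<delta> n) (cell_average (\<delta> n) (f (r j)))" for n j
  define h where "h n = interpolation (\<delta> n) (a n)" for n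
  have [measurable]: "avg n j \<in> borel_measurable borel" "h n \<in> borel_measurable borel" for n j
    by (simp_all add: avg_def h_def)
  have avg_h: "(\<lambda>j. avg n j x) \<longlonglongrightarrow> h n x" for n x
    by (simp add: avg_def h_def interpolation_cell a)
  have avg_bnd: "\<bar>avg n j x\<bar> \<le> 1" for n j x
    unfolding avg_def interpolation_cell by (intro abs_cell_average_le_1 \<delta> bnd) measurable
  have h_bnd: "\<bar>h n x\<bar> \<le> 1" for n x
    by (rule tendsto_upperbound[OF tendsto_rabs[OF avg_h]]) (simp_all add: avg_bnd)
  \<comment> \<open>\<open>lim\<close> is arbitrary where the sequence diverges; truncation to the
    interval from \<open>-1\<close> to \<open>1\<close> gives a bound everywhere and leaves genuine
    limits unchanged, since the \<open>h n\<close> obey the same bound.\<close>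
  define w where "w x = max (-1) (min 1 (lim (\<lambda>n. h n x)))" for x
  have [measurable]: "w \<in> borel_measurable borel" unfolding w_def by measurable
  have w_bnd: "\<bar>w x\<bar> \<le> 1" for x by (auto simp: w_def)
  \<comment> \<open>\<open>q n j\<close> will bound the distance from \<open>f (r j)\<close> to its
    averages at scale \<open>n\<close>, for fine scales and large \<open>j\<close>;
    \<open>q0 n\<close> is its limit in \<open>j\<close>.\<close>
  define q where "q n j = ennreal (2 ^ CARD('n) * (A * (D * \<delta> n + \<epsilon> (r j))))" for n j
  define q0 where "q0 n = 2 ^ CARD('n) * (A * (D * \<delta> n))" for n
  have \<epsilon>r: "(\<lambda>j. \<epsilon> (r j)) \<longlonglongrightarrow> 0"
    using LIMSEQ_subseq_LIMSEQ[OF \<epsilon>(2) r] by (simp add: o_def)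
  have q: "q n \<longlonglongrightarrow> ennreal (q0 n)" for n
  proof -
    have "(\<lambda>j. 2 ^ CARD('n) * (A * (D * \<delta> n + \<epsilon> (r j)))) \<longlonglongrightarrow> 2 ^ CARD('n) * (A * (D * \<delta> n + 0))"
      by (intro tendsto_intros \<epsilon>r)
    then show ?thesis unfolding q_def q0_def by (simp add: tendsto_ennrealI)
  qed
  have q0_nonneg: "q0 n \<ge> 0" for n
    unfolding q0_def D_def using \<open>A \<ge> 0\<close> \<delta>(1)[of n] by (simp add: less_imp_le)
  have "(\<lambda>j. L1_dist K (f (r j)) w) \<longlonglongrightarrow> 0" if K: "compact K" "K \<subseteq> \<Omega>" for K
  proof -
    have [measurable]: "K \<in> sets borel" using K(1) by (simp add: borel_compact)
    obtain \<rho> where \<rho>: "\<rho> > 0" "\<forall>\<^sub>F j in sequentially. \<forall>z. norm z \<le> \<rho> \<longrightarrow>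
       (\<integral>\<^sup>+x\<in>K. ennreal \<bar>f j (x + z) - f j x\<bar> \<partial>lborel) \<le> ennreal (A * (norm z + \<epsilon> j))"
      using shift[OF K] by blast
    have "(\<lambda>n. D * \<delta> n) \<longlonglongrightarrow> D * 0" by (intro tendsto_intros \<delta>0)
    then have "\<forall>\<^sub>F n in sequentially. D * \<delta> n < \<rho>"
      using \<rho>(1) order_tendstoD(2) by fastforce
    \<comment> \<open>From scale \<open>n\<^sub>0\<close> on, all translations within a cell are
      short enough for the shift estimate on this \<open>K\<close>.\<close>
    then obtain n\<^sub>0 where n\<^sub>0: "\<And>n. n \<ge> n\<^sub>0 \<Longrightarrow> D * \<delta> n < \<rho>"
      by (auto simp: eventually_sequentially)
    have close: "\<forall>\<^sub>F j in sequentially. L1_dist K (f (r j)) (avg n j) \<le> q n j" if "n \<ge> n\<^sub>0" for n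
      using eventually_subseq[OF r \<rho>(2)]
    proof eventually_elim
      case (elim j)
      have "L1_dist K (f (r j)) (avg n j) \<le> 2 ^ CARD('n) * ennreal (A * (D * \<delta> n + \<epsilon> (r j)))"
        unfolding avg_def
      proof (intro L1_dist_cell_average \<delta> bnd)
        fix z :: "real ^ 'n" assume z: "norm z \<le> CARD('n) * \<delta> n"
        then have "norm z \<le> \<rho>" using n\<^sub>0[OF that] by (simp add: D_def)
        with elim have "(\<integral>\<^sup>+x\<in>K. ennreal \<bar>f (r j) (x + z) - f (r j) x\<bar> \<partial>lborel) \<le> ennreal (A * (norm z + \<epsilon> (r j)))"
          by blast
        also have "\<dots> \<le> ennreal (A * (D * \<delta> n + \<epsilon> (r j)))"
          using z \<open>A \<ge> 0\<close> by (intro ennreal_leI mult_left_mono add_right_mono) (auto simp: D_def)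
        finally show "(\<integral>\<^sup>+x\<in>K. ennreal \<bar>f (r j) (x + z) - f (r j) x\<bar> \<partial>lborel) \<le> ennreal (A * (D * \<delta> n + \<epsilon> (r j)))" .
      qed measurable
      then show ?case
        unfolding q_def using \<open>A \<ge> 0\<close> \<epsilon>(1)[of "r j"] \<delta>(1)[of n]
        by (subst ennreal_mult) (auto simp: D_def less_imp_le simp flip: ennreal_power)
    qed
    have avg_h_L1: "(\<lambda>j. L1_dist K (avg n j) (h n)) \<longlonglongrightarrow> 0" for n
      by (intro L1_dist_tendsto_0 K avg_bnd h_bnd) (auto simp: avg_h)
    \<comment> \<open>The two limits are compared through the same \<open>f (r j)\<close>, along the
      chain \<open>h m\<close>, \<open>avg m j\<close>, \<open>f (r j)\<close>,
      \<open>avg n j\<close>, \<open>h n\<close>; then \<open>j\<close> tends to infinity.\<close>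
    have h_Cauchy: "L1_dist K (h m) (h n) \<le> ennreal (q0 m + q0 n)" if "m \<ge> n\<^sub>0" "n \<ge> n\<^sub>0" for m n
    proof (rule tendsto_lowerbound)
      show "(\<lambda>j. (L1_dist K (avg m j) (h m) + q m j) + (q n j + L1_dist K (avg n j) (h n))) \<longlonglongrightarrow> ennreal (q0 m + q0 n)"
        using tendsto_add[OF tendsto_add[OF avg_h_L1 q] tendsto_add[OF q avg_h_L1], of m m n n]
        by (simp add: q0_nonneg)
      show "\<forall>\<^sub>F j in sequentially. L1_dist K (h m) (h n) \<le>
          (L1_dist K (avg m j) (h m) + q m j) + (q n j + L1_dist K (avg n j) (h n))"
        using close[OF that(1)] close[OF that(2)]
      proof eventually_elim
        case (elim j)
        have "L1_dist K (h m) (h n) \<le> L1_dist K (h m) (f (r j)) + L1_dist K (f (r j)) (h n)"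
          by (rule L1_dist_triangle) measurable
        also have "\<dots> \<le> (L1_dist K (h m) (avg m j) + L1_dist K (avg m j) (f (r j))) +
            (L1_dist K (f (r j)) (avg n j) + L1_dist K (avg n j) (h n))"
          by (intro add_mono L1_dist_triangle) measurable
        also have "\<dots> \<le> (L1_dist K (avg m j) (h m) + q m j) + (q n j + L1_dist K (avg n j) (h n))"
          using elim by (intro add_mono) (simp_all add: L1_dist_commute)
        finally show ?case .
      qed
    qed simp
    have "AE x in lborel. x \<in> K \<longrightarrow> convergent (\<lambda>n. h n x)"
    proof (rule AE_convergent_if_L1_summable)
      show "L1_dist K (h (Suc n)) (h n) \<le> ennreal (q0 (Suc n) + q0 n)" if "n \<ge> n\<^sub>0" for n
        using that by (intro h_Cauchy) auto
      have "summable q0"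
        unfolding q0_def \<delta>_def by (intro summable_mult summable_geometric) simp
      then show "summable (\<lambda>n. q0 (Suc n) + q0 n)"
        by (intro summable_add) (simp_all add: summable_Suc_iff)
    qed (auto simp: q0_nonneg)
    then have "AE x in lborel. x \<in> K \<longrightarrow> (\<lambda>n. h n x) \<longlonglongrightarrow> w x"
    proof eventually_elim
      case (elim x)
      show ?case
      proof
        assume "x \<in> K"
        with elim have l: "(\<lambda>n. h n x) \<longlonglongrightarrow> lim (\<lambda>n. h n x)"
          by (simp add: convergent_LIMSEQ_iff)
        have "\<bar>lim (\<lambda>n. h n x)\<bar> \<le> 1"
          by (rule tendsto_upperbound[OF tendsto_rabs[OF l]]) (simp_all add: h_bnd)
        then have "w x = lim (\<lambda>n. h n x)" by (auto simp: w_def)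
        with l show "(\<lambda>n. h n x) \<longlonglongrightarrow> w x" by simp
      qed
    qed
    then have hw: "(\<lambda>n. L1_dist K (h n) w) \<longlonglongrightarrow> 0"
      by (intro L1_dist_tendsto_0 K h_bnd w_bnd) measurable
    have q0: "(\<lambda>n. ennreal (q0 n)) \<longlonglongrightarrow> 0"
    proof -
      have "q0 \<longlonglongrightarrow> 2 ^ CARD('n) * (A * (D * 0))"
        unfolding q0_def by (intro tendsto_intros \<delta>0)
      then have "(\<lambda>n. ennreal (q0 n)) \<longlonglongrightarrow> ennreal 0" by (intro tendsto_ennrealI) simp
      then show ?thesis by simp
    qed
    show ?thesis
    proof (rule ennreal_tendsto_0_squeeze)
      show "\<forall>\<^sub>F j in sequentially. L1_dist K (f (r j)) w \<le>
          q n j + (L1_dist K (avg n j) (h n) + L1_dist K (h n) w)" if "n \<ge> n\<^sub>0" for n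
        using close[OF that]
      proof eventually_elim
        case (elim j)
        have "L1_dist K (f (r j)) w \<le> L1_dist K (f (r j)) (avg n j) + L1_dist K (avg n j) w"
          by (rule L1_dist_triangle) measurable
        also have "\<dots> \<le> q n j + (L1_dist K (avg n j) (h n) + L1_dist K (h n) w)"
          using elim by (intro add_mono L1_dist_triangle) auto
        finally show ?case .
      qed
      show "(\<lambda>j. q n j + (L1_dist K (avg n j) (h n) + L1_dist K (h n) w)) \<longlonglongrightarrow>
          ennreal (q0 n) + (0 + L1_dist K (h n) w)" for n
        by (intro tendsto_add q avg_h_L1 tendsto_const)
      show "(\<lambda>n. ennreal (q0 n) + (0 + L1_dist K (h n) w)) \<longlonglongrightarrow> 0"
        using tendsto_add[OF q0 hw] by simp
    qed
  qed
  with r w_bnd \<open>w \<in> borel_measurable borel\<close> show ?thesis by (intro that)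
qed

section \<open>Variation of the limit\<close>

lemma L1_dist_translate:
  fixes f g :: "real ^ 'n \<Rightarrow> real"
  assumes [measurable]: "K \<in> sets borel" "f \<in> borel_measurable borel" "g \<in> borel_measurable borel"
    and [measurable]: "(\<lambda>x. x + z) ` K \<in> sets borel"
  shows "L1_dist K (\<lambda>x. f (x + z)) (\<lambda>x. g (x + z)) = L1_dist ((\<lambda>x. x + z) ` K) f g"
proof -
  have "L1_dist ((\<lambda>x. x + z) ` K) f g =
      (\<integral>\<^sup>+x. ennreal \<bar>f (x + z) - g (x + z)\<bar> * indicator ((\<lambda>x. x + z) ` K) (x + z) \<partial>lborel)"
    unfolding L1_dist_def by (rule nn_integral_lborel_translate[symmetric]) measurable
  moreover have "indicator ((\<lambda>x. x + z) ` K) (x + z) = (indicator K x :: ennreal)" for x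
    by (auto simp: indicator_def)
  ultimately show ?thesis by (simp add: L1_dist_def)
qed

text \<open>Convergence is used twice, on \<open>K\<close> and on its translate by \<open>z\<close>.
  The translate must stay inside the domain, so \<open>\<rho>\<close> is reduced to the margin of
  \<open>K\<close>; the error \<open>A * \<epsilon> j\<close> disappears in the limit.\<close>

lemma shift_estimate_limit:
  fixes f :: "nat \<Rightarrow> real ^ 'n \<Rightarrow> real"
  assumes [measurable]: "\<And>j. f j \<in> borel_measurable borel" "w \<in> borel_measurable borel"
    and "open \<Omega>" "A \<ge> 0" and \<epsilon>: "\<epsilon> \<longlonglongrightarrow> 0"
    and shift: "\<And>K. compact K \<Longrightarrow> K \<subseteq> \<Omega> \<Longrightarrow> \<exists>\<rho>>0. \<forall>\<^sub>F j in sequentially. \<forall>z. norm z \<le> \<rho> \<longrightarrow>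
       (\<integral>\<^sup>+x\<in>K. ennreal \<bar>f j (x + z) - f j x\<bar> \<partial>lborel) \<le> ennreal (A * (norm z + \<epsilon> j))"
    and lim: "\<And>K. compact K \<Longrightarrow> K \<subseteq> \<Omega> \<Longrightarrow> (\<lambda>j. L1_dist K (f j) w) \<longlonglongrightarrow> 0"
    and K: "compact K" "K \<subseteq> \<Omega>"
  shows "\<exists>\<rho>>0. \<forall>z. norm z \<le> \<rho> \<longrightarrow> (\<integral>\<^sup>+x\<in>K. ennreal \<bar>w (x + z) - w x\<bar> \<partial>lborel) \<le> ennreal (A * norm z)"
proof -
  have [measurable]: "K \<in> sets borel" using K(1) by (simp add: borel_compact)
  obtain \<rho> where \<rho>: "\<rho> > 0" "\<forall>\<^sub>F j in sequentially. \<forall>z. norm z \<le> \<rho> \<longrightarrow>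
      (\<integral>\<^sup>+x\<in>K. ennreal \<bar>f j (x + z) - f j x\<bar> \<partial>lborel) \<le> ennreal (A * (norm z + \<epsilon> j))"
    using shift[OF K] by blast
  obtain e where e: "e > 0" "(\<Union>x\<in>K. cball x e) \<subseteq> \<Omega>"
    using compact_subset_open_imp_cball_epsilon_subset[OF K(1) \<open>open \<Omega>\<close> K(2)] by blast
  have "(\<integral>\<^sup>+x\<in>K. ennreal \<bar>w (x + z) - w x\<bar> \<partial>lborel) \<le> ennreal (A * norm z)" if z: "norm z \<le> min \<rho> e" for z
  proof -
    let ?K = "(\<lambda>x. x + z) ` K" and ?f = "\<lambda>j x. f j (x + z)" and ?w = "\<lambda>x. w (x + z)"
    have K': "compact ?K" using K(1) by (intro compact_continuous_image continuous_intros)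
    then have [measurable]: "?K \<in> sets borel" by (simp add: borel_compact)
    have "?K \<subseteq> \<Omega>"
    proof safe
      fix x assume "x \<in> K"
      moreover have "x + z \<in> cball x e" using z by (simp add: dist_norm)
      ultimately show "x + z \<in> \<Omega>" using e(2) by blast
    qed
    from lim[OF K' this] have "(\<lambda>j. L1_dist K (?f j) ?w) \<longlonglongrightarrow> 0"
      by (subst L1_dist_translate) measurable
    moreover have "(\<lambda>j. ennreal (A * (norm z + \<epsilon> j))) \<longlonglongrightarrow> ennreal (A * (norm z + 0))"
      by (intro tendsto_ennrealI tendsto_intros \<epsilon>)
    ultimately have *: "(\<lambda>j. L1_dist K (?f j) ?w + (ennreal (A * (norm z + \<epsilon> j)) + L1_dist K (f j) w))
        \<longlonglongrightarrow> 0 + (ennreal (A * (norm z + 0)) + 0)"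
      by (intro tendsto_add lim K)
    have "L1_dist K ?w w \<le> 0 + (ennreal (A * (norm z + 0)) + 0)"
    proof (rule tendsto_lowerbound[OF *])
      show "\<forall>\<^sub>F j in sequentially. L1_dist K ?w w \<le>
          L1_dist K (?f j) ?w + (ennreal (A * (norm z + \<epsilon> j)) + L1_dist K (f j) w)"
        using \<rho>(2)
      proof eventually_elim
        case (elim j)
        have "L1_dist K ?w w \<le> L1_dist K ?w (?f j) + L1_dist K (?f j) w"
          by (rule L1_dist_triangle) measurable
        also have "\<dots> \<le> L1_dist K ?w (?f j) + (L1_dist K (?f j) (f j) + L1_dist K (f j) w)"
          by (intro add_left_mono L1_dist_triangle) measurable
        also have "L1_dist K ?w (?f j) = L1_dist K (?f j) ?w"
          by (rule L1_dist_commute)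
        also have "L1_dist K (?f j) (f j) \<le> ennreal (A * (norm z + \<epsilon> j))"
          using elim z by (simp add: L1_dist_def)
        finally show ?case by (simp add: add_left_mono add_right_mono)
      qed
    qed simp
    then show ?thesis by (simp add: L1_dist_def)
  qed
  with \<rho>(1) e(1) show ?thesis by (intro exI[of _ "min \<rho> e"]) auto
qed

section \<open>Difference quotients of test fields and the variation bound\<close>

lemma integrable_bounded_support:
  fixes f :: "real ^ 'n \<Rightarrow> real"
  assumes "f \<in> borel_measurable borel" "\<And>x. \<bar>f x\<bar> \<le> B" "\<And>x. norm x > r \<Longrightarrow> f x = 0"
  shows "integrable lborel f"
  by (rule integrableI_bounded_set[where A = "cball 0 r" and B = B])
     (use assms emeasure_lborel_cball_finite in \<open>auto simp: not_le\<close>)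

lemma lborel_integral_translate:
  fixes f :: "real ^ 'n \<Rightarrow> real"
  assumes [measurable]: "f \<in> borel_measurable borel"
  shows "(LBINT x. f (x + a)) = (LBINT x. f x)"
proof -
  have "(LBINT x. f x) = integral\<^sup>L (distr lborel borel ((+) a)) f"
    by (simp add: lborel_distr_plus)
  also have "\<dots> = (LBINT x. f (a + x))"
    by (rule integral_distr) auto
  finally show ?thesis by (simp add: add.commute)
qed

lemma test_field_partial_derivative:
  assumes "test_field V \<phi>"
  shows "((\<lambda>t. \<phi> (x + t *\<^sub>R axis i 1) $ i) has_real_derivative
     frechet_derivative \<phi> (at (x + t *\<^sub>R axis i 1)) (axis i 1) $ i) (at t)"
proof -
  let ?y = "x + t *\<^sub>R axis i 1" and ?e = "axis i 1 :: real ^ 'a"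
  have d: "(\<phi> has_derivative frechet_derivative \<phi> (at ?y)) (at ?y)"
    using assms frechet_derivative_works by (auto simp: test_field_def)
  have "((\<lambda>t. x + t *\<^sub>R ?e) has_derivative (\<lambda>s. s *\<^sub>R ?e)) (at t)"
    by (auto intro!: derivative_eq_intros)
  from has_derivative_compose[OF this d]
  have "((\<lambda>t. \<phi> (x + t *\<^sub>R ?e) $ i) has_derivative (\<lambda>s. frechet_derivative \<phi> (at ?y) (s *\<^sub>R ?e) $ i)) (at t)"
    by (rule bounded_linear.has_derivative[OF bounded_linear_vec_nth])
  moreover have "frechet_derivative \<phi> (at ?y) (s *\<^sub>R ?e) $ i = frechet_derivative \<phi> (at ?y) ?e $ i * s" for s
    using linear_scale[OF has_derivative_linear[OF d]] by (simp add: mult.commute)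
  ultimately show ?thesis by (simp add: has_field_derivative_def)
qed

text \<open>The complement of the closed support is an open neighbourhood of \<open>x\<close> on
  which the field is zero.\<close>

lemma test_field_derivative_outside:
  assumes "test_field V \<phi>" "x \<notin> closure {x. \<phi> x \<noteq> 0}"
  shows "frechet_derivative \<phi> (at x) h = 0"
proof -
  have "(\<phi> has_derivative (\<lambda>_. 0)) (at x)"
  proof (rule has_derivative_transform_within_open[OF has_derivative_const[of 0]])
    show "open (- closure {x. \<phi> x \<noteq> 0})" by (intro open_Compl closed_closure)
    show "0 = \<phi> y" if "y \<in> - closure {x. \<phi> x \<noteq> 0}" for y
      using that closure_subset[of "{x. \<phi> x \<noteq> 0}"] by auto
  qed (use assms(2) in simp)
  from frechet_derivative_at[OF this] show ?thesis by metis
qed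

text \<open>The partial derivative is the limit of difference quotients of step \<open>h n\<close>.
  Translation invariance moves the difference from \<open>\<phi>\<close> to \<open>w\<close>, where
  the shift estimate gives \<open>A * h n\<close>; dividing by \<open>h n\<close> leaves
  \<open>A\<close>.\<close>

lemma partial_derivative_pairing_le:
  fixes w :: "real ^ 'n \<Rightarrow> real" and \<phi> :: "real ^ 'n \<Rightarrow> real ^ 'n" and i :: 'n
  defines "D \<equiv> \<lambda>x. frechet_derivative \<phi> (at x) (axis i 1) $ i"
  assumes [measurable]: "w \<in> borel_measurable borel" and w: "\<And>x. \<bar>w x\<bar> \<le> 1" and "A \<ge> 0"
    and shift: "\<And>K. compact K \<Longrightarrow> K \<subseteq> V \<Longrightarrow> \<exists>\<rho>>0. \<forall>z. norm z \<le> \<rho> \<longrightarrow>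
      (\<integral>\<^sup>+x\<in>K. ennreal \<bar>w (x + z) - w x\<bar> \<partial>lborel) \<le> ennreal (A * norm z)"
    and \<phi>: "test_field V \<phi>" "\<And>x. norm (\<phi> x) \<le> 1"
  shows "integrable lborel (\<lambda>x. w x * D x)" "(LBINT x. w x * D x) \<le> A"
proof -
  define K where "K = closure {x. \<phi> x \<noteq> 0}"
  define e where "e = (axis i 1 :: real ^ 'n)"
  define p where "p x = \<phi> x $ i" for x
  have K: "compact K" "K \<subseteq> V" using \<phi>(1) by (auto simp: test_field_def K_def)
  have [measurable]: "K \<in> sets borel" using K(1) by (simp add: borel_compact)
  obtain r where r: "\<And>x. x \<in> K \<Longrightarrow> norm x \<le> r"
    using compact_imp_bounded[OF K(1)] bounded_iff by blast
  have ne: "norm e = 1" by (simp add: e_def)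
  have p0: "p x = 0" if "x \<notin> K" for x
  proof -
    have "\<phi> x = 0" using that closure_subset[of "{x. \<phi> x \<noteq> 0}"] unfolding K_def by blast
    then show ?thesis by (simp add: p_def)
  qed
  have p1: "\<bar>p x\<bar> \<le> 1" for x
    using component_le_norm_cart[of "\<phi> x" i] \<phi>(2)[of x] by (simp add: p_def)
  have "continuous_on UNIV \<phi>"
    using \<phi>(1) differentiable_imp_continuous_within
    by (auto simp: test_field_def continuous_on_eq_continuous_within)
  then have [measurable]: "p \<in> borel_measurable borel"
    unfolding p_def by (intro borel_measurable_continuous_onI continuous_intros)
  have Dcont: "continuous_on UNIV D"
    using \<phi>(1) unfolding D_def test_field_def by (intro continuous_intros) auto
  then have [measurable]: "D \<in> borel_measurable borel"
    by (rule borel_measurable_continuous_onI)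
  have D0: "D x = 0" if "x \<notin> K" for x
    using test_field_derivative_outside[OF \<phi>(1)] that by (simp add: D_def K_def)
  obtain M where "\<And>x. x \<in> K \<Longrightarrow> \<bar>D x\<bar> \<le> M"
    using compact_imp_bounded[OF compact_continuous_image[OF continuous_on_subset[OF Dcont subset_UNIV] K(1)]]
    by (auto simp: bounded_iff)
  \<comment> \<open>\<open>M\<close> is constrained only when \<open>K\<close> is nonempty, hence
    the maximum with \<open>0\<close>.\<close>
  then have M: "\<bar>D x\<bar> \<le> max M 0" for x
    using D0[of x] by (cases "x \<in> K") force+
  have deriv: "((\<lambda>t. p (x + t *\<^sub>R e)) has_real_derivative D (x + t *\<^sub>R e)) (at t)" for x t
    unfolding p_def D_def e_def by (rule test_field_partial_derivative[OF \<phi>(1)])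
  define h where "h n = 1 / real (Suc n)" for n
  have h: "h n > 0" "h n \<le> 1" for n by (auto simp: h_def)
  have h0: "h \<longlonglongrightarrow> 0" unfolding h_def using LIMSEQ_inverse_real_of_nat by (simp add: inverse_eq_divide)
  define Q where "Q n x = (p (x + h n *\<^sub>R e) - p x) / h n" for n x
  have [measurable]: "Q n \<in> borel_measurable borel" for n unfolding Q_def by measurable
  \<comment> \<open>By the mean value theorem the quotients inherit the bound on the derivative,
    which provides the dominating function below.\<close>
  have Q_bound: "\<bar>Q n x\<bar> \<le> max M 0" for n x
  proof -
    obtain s where "p (x + h n *\<^sub>R e) - p (x + 0 *\<^sub>R e) = (h n - 0) * D (x + s *\<^sub>R e)"
      using MVT2[OF h(1)[of n], of "\<lambda>t. p (x + t *\<^sub>R e)" "\<lambda>t. D (x + t *\<^sub>R e)"] deriv by blast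
    then have "Q n x = D (x + s *\<^sub>R e)" using h(1)[of n] by (simp add: Q_def)
    with M show ?thesis by simp
  qed
  have outside: "x \<notin> K" "x + h n *\<^sub>R e \<notin> K" if "norm x > r + 1" for n x
  proof -
    show "x \<notin> K" using r[of x] that by auto
    have "norm x - norm (h n *\<^sub>R e) \<le> norm (x + h n *\<^sub>R e)" by (rule norm_diff_ineq)
    moreover have "norm (h n *\<^sub>R e) \<le> 1" using h[of n] ne by simp
    ultimately show "x + h n *\<^sub>R e \<notin> K" using r[of "x + h n *\<^sub>R e"] that by auto
  qed
  have Q0: "Q n x = 0" if "norm x > r + 1" for n x
    using outside[OF that] by (simp add: Q_def p0)
  have Q_lim: "(\<lambda>n. Q n x) \<longlonglongrightarrow> D x" for x
  proof -
    have "((\<lambda>t. (p (x + t *\<^sub>R e) - p x) / t) \<longlongrightarrow> D x) (at 0)"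
      using deriv[of x 0] by (simp add: DERIV_def)
    moreover have "filterlim h (at 0) sequentially"
      using h0 h(1) by (intro filterlim_atI) (auto intro!: always_eventually less_imp_neq[symmetric])
    ultimately show ?thesis unfolding Q_def by (rule filterlim_compose)
  qed
  have abs_w: "\<bar>w x * y\<bar> \<le> \<bar>y\<bar>" for x y
    using w[of x] by (simp add: abs_mult mult_left_le_one_le)
  \<comment> \<open>The support of \<open>p\<close> lies in the ball of radius \<open>r\<close>, and
    steps \<open>h n \<le> 1\<close> enlarge it by at most \<open>1\<close>.\<close>
  have bound_int: "integrable lborel (\<lambda>x :: real ^ 'n. max M 0 * indicator (cball 0 (r + 1)) x)"
    by (rule integrable_bounded_support[where B = "max M 0" and r = "r + 1"]) (auto simp: indicator_def)
  have dc: "\<bar>w x * Q n x\<bar> \<le> max M 0 * indicator (cball 0 (r + 1)) x" for n x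
    using order_trans[OF abs_w Q_bound] Q0[of x n] by (auto simp: indicator_def not_le)
  have conv: "(\<lambda>n. LBINT x. w x * Q n x) \<longlonglongrightarrow> (LBINT x. w x * D x)"
    by (rule integral_dominated_convergence[OF _ _ bound_int])
       (auto intro!: tendsto_intros Q_lim always_eventually dc)
  show "integrable lborel (\<lambda>x. w x * D x)"
  proof (rule integrable_bounded_support)
    show "\<bar>w x * D x\<bar> \<le> max M 0" for x using order_trans[OF abs_w M] .
    show "w x * D x = 0" if "norm x > r" for x using r[of x] that D0[of x] by auto
  qed measurable
  obtain \<rho> where \<rho>: "\<rho> > 0" "\<And>z. norm z \<le> \<rho> \<Longrightarrow>
      (\<integral>\<^sup>+x\<in>K. ennreal \<bar>w (x + z) - w x\<bar> \<partial>lborel) \<le> ennreal (A * norm z)"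
    using shift[OF K] by blast
  have Q_le: "(LBINT x. w x * Q n x) \<le> A" if "h n < \<rho>" for n
  proof -
    let ?z = "- (h n *\<^sub>R e)"
    have pK: "\<bar>p x * y\<bar> \<le> \<bar>y\<bar> * indicator K x" for x y
      using p1[of x] p0[of x] by (auto simp: indicator_def abs_mult mult_left_le_one_le)
    have int1: "integrable lborel (\<lambda>x. w x * p (x + h n *\<^sub>R e))"
      by (rule integrable_bounded_support[where B = 1 and r = "r + 1"])
         (auto simp: outside p0 intro!: order_trans[OF abs_w p1])
    have int2: "integrable lborel (\<lambda>x. w x * p x)"
      by (rule integrable_bounded_support[where B = 1 and r = "r + 1"])
         (auto simp: outside p0 intro!: order_trans[OF abs_w p1])
    have "integrable lborel (\<lambda>x. w (x + ?z) * p x)"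
      by (rule integrable_bounded_support[where B = 1 and r = "r + 1"])
         (auto simp: outside p0 intro!: order_trans[OF abs_w p1])
    from Bochner_Integration.integrable_diff[OF this int2]
    have int3: "integrable lborel (\<lambda>x. p x * (w (x + ?z) - w x))"
      by (simp add: algebra_simps)
    have "h n * (w x * Q n x) = w x * p (x + h n *\<^sub>R e) - w x * p x" for x
    proof -
      have "h n * Q n x = p (x + h n *\<^sub>R e) - p x" using h(1)[of n] by (simp add: Q_def)
      then show ?thesis by (simp only: mult.left_commute[of "h n"] right_diff_distrib)
    qed
    then have "h n * (LBINT x. w x * Q n x) = (LBINT x. w x * p (x + h n *\<^sub>R e) - w x * p x)"
      by (simp only: integral_mult_right_zero[symmetric])
    also have "\<dots> = (LBINT x. w x * p (x + h n *\<^sub>R e)) - (LBINT x. w x * p x)"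
      by (rule Bochner_Integration.integral_diff[OF int1 int2])
    \<comment> \<open>Discrete integration by parts: translating by \<open>?z\<close> removes the
      shift from \<open>p\<close> and puts the opposite one on \<open>w\<close>.\<close>
    also have "(LBINT x. w x * p (x + h n *\<^sub>R e)) = (LBINT x. w (x + ?z) * p x)"
      using lborel_integral_translate[of "\<lambda>x. w x * p (x + h n *\<^sub>R e)" ?z] by simp
    also have "(LBINT x. w (x + ?z) * p x) - (LBINT x. w x * p x) = (LBINT x. p x * (w (x + ?z) - w x))"
      by (subst Bochner_Integration.integral_diff[symmetric])
         (use int2 \<open>integrable lborel (\<lambda>x. w (x + ?z) * p x)\<close> in \<open>auto simp: algebra_simps\<close>)
    also have "ennreal \<dots> \<le> ennreal (LBINT x. \<bar>p x * (w (x + ?z) - w x)\<bar>)"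
      by (intro ennreal_leI integral_mono int3 integrable_abs) auto
    also have "\<dots> = (\<integral>\<^sup>+x. ennreal \<bar>p x * (w (x + ?z) - w x)\<bar> \<partial>lborel)"
      by (intro nn_integral_eq_integral[symmetric] integrable_abs int3) auto
    \<comment> \<open>Since \<open>p\<close> is bounded by \<open>1\<close> and vanishes off
      \<open>K\<close>, it can be replaced by the indicator of \<open>K\<close>.\<close>
    also have "\<dots> \<le> (\<integral>\<^sup>+x\<in>K. ennreal \<bar>w (x + ?z) - w x\<bar> \<partial>lborel)"
    proof (intro nn_integral_mono)
      show "ennreal \<bar>p x * (w (x + ?z) - w x)\<bar> \<le> ennreal \<bar>w (x + ?z) - w x\<bar> * indicator K x" for x
        using ennreal_leI[OF pK[of x "w (x + ?z) - w x"]] by (auto simp: indicator_def)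
    qed
    also have "\<dots> \<le> ennreal (A * norm ?z)"
      using that h(1)[of n] ne by (intro \<rho>(2)) simp
    also have "A * norm ?z = h n * A"
      using h(1)[of n] ne by simp
    finally have "h n * (LBINT x. w x * Q n x) \<le> h n * A"
      using \<open>A \<ge> 0\<close> h(1)[of n] by (subst (asm) ennreal_le_iff) auto
    with h(1)[of n] show ?thesis by simp
  qed
  have "\<forall>\<^sub>F n in sequentially. (LBINT x. w x * Q n x) \<le> A"
    using order_tendstoD(2)[OF h0 \<rho>(1)] by eventually_elim (rule Q_le)
  with conv show "(LBINT x. w x * D x) \<le> A"
    by (intro tendsto_upperbound) auto
qed

text \<open>The divergence is a sum of \<open>CARD('n)\<close> partial derivatives, and each one
  pairs with \<open>w\<close> to at most \<open>A\<close>.\<close>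

lemma variation_le:
  fixes w :: "real ^ 'n \<Rightarrow> real" and A :: real
  assumes [measurable]: "w \<in> borel_measurable borel" and w: "\<And>x. \<bar>w x\<bar> \<le> 1" and "A \<ge> 0"
    and shift: "\<And>K. compact K \<Longrightarrow> K \<subseteq> V \<Longrightarrow> \<exists>\<rho>>0. \<forall>z. norm z \<le> \<rho> \<longrightarrow>
      (\<integral>\<^sup>+x\<in>K. ennreal \<bar>w (x + z) - w x\<bar> \<partial>lborel) \<le> ennreal (A * norm z)"
    and "open V"
  shows "variation w V \<le> ereal (CARD('n) * A)"
  unfolding variation_def
proof (rule SUP_least)
  fix \<phi> assume "\<phi> \<in> {\<phi>. test_field V \<phi> \<and> (\<forall>x. norm (\<phi> x) \<le> 1)}"
  then have \<phi>: "test_field V \<phi>" "\<And>x. norm (\<phi> x) \<le> 1" by auto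
  let ?D = "\<lambda>i x. frechet_derivative \<phi> (at x) (axis i 1) $ i"
  note D = partial_derivative_pairing_le[OF assms(1) w \<open>A \<ge> 0\<close> shift \<phi>]
  \<comment> \<open>This turns the integral over \<open>V\<close> into one over the whole space, the
    form in which the partial derivatives were estimated.\<close>
  have "divergence \<phi> x = 0" if "x \<notin> V" for x
  proof -
    have "x \<notin> closure {x. \<phi> x \<noteq> 0}" using that \<phi>(1) by (auto simp: test_field_def)
    then show ?thesis by (simp add: divergence_def test_field_derivative_outside[OF \<phi>(1)])
  qed
  then have eq: "indicator V x *\<^sub>R (w x * divergence \<phi> x) = (\<Sum>i\<in>UNIV. w x * ?D i x)" for x
    by (cases "x \<in> V") (auto simp: divergence_def sum_distrib_left simp flip: sum_distrib_left)
  have "(LINT x:V|lebesgue. w x * divergence \<phi> x) = (LBINT x. \<Sum>i\<in>UNIV. w x * ?D i x)"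
    unfolding set_lebesgue_integral_def eq
    by (intro integral_completion borel_measurable_integrable Bochner_Integration.integrable_sum D)
  also have "\<dots> = (\<Sum>i\<in>UNIV. LBINT x. w x * ?D i x)"
    by (intro Bochner_Integration.integral_sum D)
  also have "\<dots> \<le> (\<Sum>i\<in>(UNIV :: 'n set). A)"
    by (intro sum_mono D)
  finally show "ereal (LINT x:V|lebesgue. w x * divergence \<phi> x) \<le> ereal (CARD('n) * A)"
    by simp
qed

section \<open>Transfer to Lebesgue integrals and values of the limit\<close>

lemma set_integrable_compact_bounded:
  fixes f :: "real ^ 'n \<Rightarrow> real"
  assumes [measurable]: "f \<in> borel_measurable borel" and "\<And>x. \<bar>f x\<bar> \<le> B" "compact K"
  shows "set_integrable lebesgue K f"
proof -
  have [measurable]: "K \<in> sets borel" using assms(3) by (simp add: borel_compact)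
  have "integrable lborel (\<lambda>x. indicator K x *\<^sub>R f x)"
    using assms emeasure_compact_finite[OF assms(3)]
    by (intro integrableI_bounded_set_indicator[where B = B]) auto
  then show ?thesis
    unfolding set_integrable_def by (subst integrable_completion) auto
qed

text \<open>Links the Borel, \<open>ennreal\<close>-valued distance of the compactness argument to
  the integrals in \<open>L1_loc_converges\<close>.\<close>

lemma set_integral_abs_diff:
  fixes f g :: "real ^ 'n \<Rightarrow> real"
  assumes [measurable]: "f \<in> borel_measurable borel" "g \<in> borel_measurable borel" "K \<in> sets borel"
  shows "(LINT x:K|lebesgue. \<bar>f x - g x\<bar>) = enn2real (L1_dist K f g)"
proof -
  have "(LINT x:K|lebesgue. \<bar>f x - g x\<bar>) = (LBINT x. indicator K x *\<^sub>R \<bar>f x - g x\<bar>)"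
    unfolding set_lebesgue_integral_def by (rule integral_completion) measurable
  also have "\<dots> = enn2real (\<integral>\<^sup>+x. ennreal (indicator K x *\<^sub>R \<bar>f x - g x\<bar>) \<partial>lborel)"
    by (rule integral_eq_nn_integral) auto
  also have "(\<integral>\<^sup>+x. ennreal (indicator K x *\<^sub>R \<bar>f x - g x\<bar>) \<partial>lborel) = L1_dist K f g"
    unfolding L1_dist_def by (intro nn_integral_cong) (auto split: split_indicator)
  finally show ?thesis .
qed

text \<open>Because \<open>\<bar>f j x\<bar> = 1\<close>, the reverse triangle inequality bounds the
  integral of \<open>\<bar>1 - \<bar>w x\<bar>\<bar>\<close> over a compact set by the distance from
  \<open>f j\<close> to \<open>w\<close>, which tends to \<open>0\<close>. Countably many compact
  sets exhaust the domain.\<close>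

lemma L1_limit_spin:
  fixes f :: "nat \<Rightarrow> real ^ 'n \<Rightarrow> real"
  assumes [measurable]: "\<And>j. f j \<in> borel_measurable borel" "w \<in> borel_measurable borel"
    and f: "\<And>j x. \<bar>f j x\<bar> = 1" and "open \<Omega>"
    and lim: "\<And>K. compact K \<Longrightarrow> K \<subseteq> \<Omega> \<Longrightarrow> (\<lambda>j. L1_dist K (f j) w) \<longlonglongrightarrow> 0"
  shows "AE x in lborel. x \<in> \<Omega> \<longrightarrow> \<bar>w x\<bar> = 1"
proof -
  obtain K where K: "\<And>n :: nat. compact (K n)" "\<And>n. K n \<subseteq> \<Omega>" "\<Union>(range K) = \<Omega>"
    using open_Union_compact_subsets[OF \<open>open \<Omega>\<close>] by metis
  have "AE x in lborel. x \<in> K n \<longrightarrow> \<bar>w x\<bar> = 1" for n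
  proof -
    have [measurable]: "K n \<in> sets borel" using K(1) by (simp add: borel_compact)
    have "(\<integral>\<^sup>+x\<in>K n. ennreal \<bar>1 - \<bar>w x\<bar>\<bar> \<partial>lborel) \<le> 0"
    proof (rule tendsto_lowerbound[OF lim[OF K(1,2), of n]])
      have "(\<integral>\<^sup>+x\<in>K n. ennreal \<bar>1 - \<bar>w x\<bar>\<bar> \<partial>lborel) \<le> L1_dist (K n) (f j) w" for j
        unfolding L1_dist_def
      proof (intro nn_integral_mono mult_right_mono ennreal_leI)
        show "\<bar>1 - \<bar>w x\<bar>\<bar> \<le> \<bar>f j x - w x\<bar>" for x
          using abs_triangle_ineq3[of "f j x" "w x"] f[of j x] by simp
      qed simp
      then show "\<forall>\<^sub>F j in sequentially. (\<integral>\<^sup>+x\<in>K n. ennreal \<bar>1 - \<bar>w x\<bar>\<bar> \<partial>lborel) \<le> L1_dist (K n) (f j) w"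
        by (intro always_eventually allI)
    qed simp
    then have "AE x in lborel. ennreal \<bar>1 - \<bar>w x\<bar>\<bar> * indicator (K n) x = 0"
      by (subst nn_integral_0_iff_AE[symmetric]) auto
    then show ?thesis
      by eventually_elim auto
  qed
  then have "AE x in lborel. \<forall>n. x \<in> K n \<longrightarrow> \<bar>w x\<bar> = 1"
    by (intro AE_all_countable[THEN iffD2] allI)
  then show ?thesis
    by eventually_elim (use K(3) in blast)
qed

section \<open>Equicoercivity\<close>

theorem lemma3p2:
  fixes T :: nat
    and C :: "(int ^ 'n) set"
    and P :: "int ^ 'n \<Rightarrow> (int ^ 'n) set"
  assumes "T > 0"
    and "C \<noteq> {}"
    and "periodic_set T C"
    and "connection_system T C P"
    and "P_connected C P"
  shows "\<exists>c::real. c > 0 \<and>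
    (\<forall>(\<Omega> :: (real ^ 'n) set) (\<epsilon> :: nat \<Rightarrow> real) (u :: nat \<Rightarrow> int ^ 'n \<Rightarrow> real).
       open \<Omega> \<and> bounded \<Omega> \<and> lipschitz_boundary \<Omega> \<and>
       (\<forall>j. \<epsilon> j > 0) \<and> \<epsilon> \<longlonglongrightarrow> 0 \<and>
       (\<forall>j. \<forall>k\<in>lattice_points (\<epsilon> j) \<Omega>. u j k \<in> {1, -1}) \<and>
       bdd_above (range (\<lambda>j. \<epsilon> j ^ (CARD('n) - 1) *
         real (card {(k, k') \<in> neighbours C P (\<epsilon> j) \<Omega>. u j k \<noteq> u j k'})))
       \<longrightarrow>
       (\<exists>u' :: nat \<Rightarrow> int ^ 'n \<Rightarrow> real.
          (\<forall>j. \<forall>k\<in>lattice_points (\<epsilon> j) \<Omega>. u' j k \<in> {1, -1}) \<and>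
          (\<forall>j. \<forall>k\<in>C \<inter> lattice_points (\<epsilon> j) \<Omega>.
             infdist (lattice_vec k) (frontier (dilate (\<epsilon> j) \<Omega>)) > c \<longrightarrow> u' j k = u j k) \<and>
          (\<exists>r :: nat \<Rightarrow> nat. \<exists>w\<in>BV_loc_spin \<Omega>. strict_mono r \<and>
             L1_loc_converges \<Omega>
               (\<lambda>j. interpolation (\<epsilon> (r j)) (u' (r j))) w)))"
proof (intro exI[of _ 1] conjI allI impI, simp, elim conjE)
  fix \<Omega> :: "(real ^ 'n) set" and \<epsilon> :: "nat \<Rightarrow> real" and u :: "nat \<Rightarrow> int ^ 'n \<Rightarrow> real"
  assume \<Omega>: "open \<Omega>" "bounded \<Omega>" and \<epsilon>: "\<forall>j. \<epsilon> j > 0" "\<epsilon> \<longlonglongrightarrow> 0"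
    and u: "\<forall>j. \<forall>k\<in>lattice_points (\<epsilon> j) \<Omega>. u j k \<in> {1, -1}"
    and bdd: "bdd_above (range (\<lambda>j. \<epsilon> j ^ (CARD('n) - 1) *
         real (card {(k, k') \<in> neighbours C P (\<epsilon> j) \<Omega>. u j k \<noteq> u j k'})))"
  obtain k\<^sub>0 where k0: "k\<^sub>0 \<in> C" using assms(2) by blast
  obtain R where R: "connecting_radius T C P k\<^sub>0 R"
    using connecting_radius_exists[OF assms(1,3,4,5) k0] by blast
  define u' where "u' j = lattice_extension T C k\<^sub>0 (\<epsilon> j) \<Omega> (u j)" for j
  define f where "f j = interpolation (\<epsilon> j) (u' j)" for j
  have u'_spin: "u' j k \<in> {1, -1}" for j k
    using u by (simp add: u'_def lattice_extension_def)
  \<comment> \<open>The retraction fixes \<open>C\<close> pointwise, so agreement holds at every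
    point of \<open>C\<close> in the dilated domain, right up to the boundary. This justifies the
    witness \<open>1\<close> for \<open>c\<close>.\<close>
  have u'_eq: "u' j k = u j k" if "k \<in> C \<inter> lattice_points (\<epsilon> j) \<Omega>" for j k
    using that by (simp add: u'_def lattice_extension_def retract_lattice_def)
  have f_meas [measurable]: "f j \<in> borel_measurable borel" for j
    by (simp add: f_def)
  have f_spin: "\<bar>f j x\<bar> = 1" for j x
    using u'_spin[of j "cell (\<epsilon> j) x"] by (auto simp: f_def interpolation_cell)
  then have f_bnd: "\<bar>f j x\<bar> \<le> 1" for j x by simp
  obtain B where "\<epsilon> j ^ (CARD('n) - 1) * real (card (jumps C P (\<epsilon> j) \<Omega> (u j))) \<le> B" for j
    using bdd by (auto simp: bdd_above_def jumps_def)
  from shift_estimate[OF R \<Omega> \<epsilon>(1)[rule_format] \<epsilon>(2) u[rule_format] this]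
  obtain A where A: "A \<ge> 0"
    and shift: "\<And>K. compact K \<Longrightarrow> K \<subseteq> \<Omega> \<Longrightarrow> \<exists>\<rho>>0. \<forall>\<^sub>F j in sequentially. \<forall>z. norm z \<le> \<rho> \<longrightarrow>
       (\<integral>\<^sup>+x\<in>K. ennreal \<bar>f j (x + z) - f j x\<bar> \<partial>lborel) \<le> ennreal (A * (norm z + \<epsilon> j))"
    unfolding f_def u'_def by blast
  obtain r w where r: "strict_mono (r :: nat \<Rightarrow> nat)" and w [measurable]: "w \<in> borel_measurable borel"
    and w_bnd: "\<And>x. \<bar>w x\<bar> \<le> 1"
    and lim: "\<And>K. compact K \<Longrightarrow> K \<subseteq> \<Omega> \<Longrightarrow> (\<lambda>j. L1_dist K (f (r j)) w) \<longlonglongrightarrow> 0"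
    using L1_loc_compactness[OF f_meas f_bnd A less_imp_le[OF \<epsilon>(1)[rule_format]] \<epsilon>(2) shift] by blast
  have \<epsilon>r: "(\<lambda>j. \<epsilon> (r j)) \<longlonglongrightarrow> 0"
    using LIMSEQ_subseq_LIMSEQ[OF \<epsilon>(2) r] by (simp add: o_def)
  \<comment> \<open>The shift estimate survives passage to the subsequence \<open>r\<close>, because
    it holds for all large \<open>j\<close> with a constant free of \<open>j\<close>.\<close>
  have w_shift: "\<exists>\<rho>>0. \<forall>z. norm z \<le> \<rho> \<longrightarrow>
      (\<integral>\<^sup>+x\<in>K. ennreal \<bar>w (x + z) - w x\<bar> \<partial>lborel) \<le> ennreal (A * norm z)"
    if K: "compact K" "K \<subseteq> \<Omega>" for K
  proof (rule shift_estimate_limit[OF f_meas w \<Omega>(1) A \<epsilon>r _ lim K])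
    fix K assume "compact K" "K \<subseteq> \<Omega>"
    then obtain \<rho> where "\<rho> > 0" "\<forall>\<^sub>F j in sequentially. \<forall>z. norm z \<le> \<rho> \<longrightarrow>
       (\<integral>\<^sup>+x\<in>K. ennreal \<bar>f j (x + z) - f j x\<bar> \<partial>lborel) \<le> ennreal (A * (norm z + \<epsilon> j))"
      using shift by blast
    then show "\<exists>\<rho>>0. \<forall>\<^sub>F j in sequentially. \<forall>z. norm z \<le> \<rho> \<longrightarrow>
       (\<integral>\<^sup>+x\<in>K. ennreal \<bar>f (r j) (x + z) - f (r j) x\<bar> \<partial>lborel) \<le> ennreal (A * (norm z + \<epsilon> (r j)))"
      using eventually_subseq[OF r] by blast
  qed
  have w_int: "locally_integrable_on w \<Omega>"
    unfolding locally_integrable_on_def using set_integrable_compact_bounded[OF w w_bnd] by blast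
  \<comment> \<open>Compact subsets of \<open>V\<close> are compact in the domain, so the same
    \<open>A\<close> serves every \<open>V\<close> and the bound is uniform.\<close>
  have "variation w V < \<infinity>" if "open V" "closure V \<subseteq> \<Omega>" for V
  proof -
    have "V \<subseteq> \<Omega>" using that(2) closure_subset by blast
    then have "variation w V \<le> ereal (CARD('n) * A)"
      by (intro variation_le[OF w w_bnd A _ \<open>open V\<close>] w_shift) auto
    then show ?thesis by (rule le_less_trans) simp
  qed
  moreover have "AE x in lebesgue. x \<in> \<Omega> \<longrightarrow> w x \<in> {1, -1}"
  proof -
    have "AE x in lborel. x \<in> \<Omega> \<longrightarrow> \<bar>w x\<bar> = 1"
      by (rule L1_limit_spin[OF f_meas w f_spin \<Omega>(1) lim])
    then have "AE x in lborel. x \<in> \<Omega> \<longrightarrow> w x \<in> {1, -1}"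
      by eventually_elim (auto simp: abs_if split: if_splits)
    then show ?thesis by (rule AE_completion)
  qed
  ultimately have w_BV: "w \<in> BV_loc_spin \<Omega>"
    using w_int by (simp add: BV_loc_spin_def BV_loc_def)
  have conv: "L1_loc_converges \<Omega> (\<lambda>j. f (r j)) w"
    unfolding L1_loc_converges_def
  proof (intro conjI allI impI w_int)
    show "locally_integrable_on (f (r j)) \<Omega>" for j
      unfolding locally_integrable_on_def using set_integrable_compact_bounded[OF f_meas f_bnd] by blast
    fix K assume K: "compact K \<and> K \<subseteq> \<Omega>"
    then have "(\<lambda>j. L1_dist K (f (r j)) w) \<longlonglongrightarrow> ennreal 0"
      using lim by simp
    \<comment> \<open>The limit \<open>0\<close> is finite, and at finite values
      \<open>enn2real\<close> preserves convergence.\<close>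
    then have "(\<lambda>j. enn2real (L1_dist K (f (r j)) w)) \<longlonglongrightarrow> 0"
      by (rule tendsto_enn2real) simp
    with K show "(\<lambda>j. LINT x:K|lebesgue. \<bar>f (r j) x - w x\<bar>) \<longlonglongrightarrow> 0"
      by (simp add: set_integral_abs_diff borel_compact)
  qed
  show "\<exists>u' :: nat \<Rightarrow> int ^ 'n \<Rightarrow> real.
          (\<forall>j. \<forall>k\<in>lattice_points (\<epsilon> j) \<Omega>. u' j k \<in> {1, -1}) \<and>
          (\<forall>j. \<forall>k\<in>C \<inter> lattice_points (\<epsilon> j) \<Omega>.
             infdist (lattice_vec k) (frontier (dilate (\<epsilon> j) \<Omega>)) > 1 \<longrightarrow> u' j k = u j k) \<and>
          (\<exists>r :: nat \<Rightarrow> nat. \<exists>w\<in>BV_loc_spin \<Omega>. strict_mono r \<and>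
             L1_loc_converges \<Omega>
               (\<lambda>j. interpolation (\<epsilon> (r j)) (u' (r j))) w)"
    using u'_spin u'_eq r w_BV conv unfolding f_def
    by (intro exI[of _ u'] conjI exI[of _ r] bexI[of _ w]) blast+
qed

end
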